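(* The graph $\mathrm{Torus}=K_3\times K_3=K_3\square K_3$ has no quantum symmetry, that is, the canonical surjection $A(\mathrm{Torus})\to\mathbb C(G(\mathrm{Torus}))$ is an isomorphism (equivalently, the algebra $A(\mathrm{Torus})$ is commutative).
   Context: $K_3$ is the triangle. The direct product $X\times Y$ of graphs has vertex set $X\times Y$ and edges $(i,\alpha)\sim(j,\beta)$ iff $i\sim j$ and $\alpha\sim\beta$; the Cartesian product $X\square Y$ has vertex set $X\times Y$ and edges $(i,\alpha)\sim(j,\beta)$ iff ($i=j$ and $\alpha\sim\beta$) or ($i\sim j$ and $\alpha=\beta$). The graphs $K_3\times K_3$ and $K_3\square K_3$ are isomorphic. A magic unitary is a square matrix over a unital $\mathbb C^*$-algebra whose entries are projections and each of whose rows and columns consists of pairwise orthogonal projections with sum $1$. For a finite (simple, undirected) graph $X$ with vertex set $\{1,\dots,n\}$ and adjacency matrix $d$, $A(X)$ is the universal unital $\mathbb C^*$-algebra generated by elements $u_{ij}$ ($1\le i,j\le n$) subject to the relations making $u=(u_{ij})$ a magic unitary and $du=ud$; it is a Hopf $\mathbb C^*$-algebra with $\Delta(u_{ij})=\sum_k u_{ik}\otimes u_{kj}$, $\varepsilon(u_{ij})=\delta_{ij}$, $S(u_{ij})=u_{ji}$. $G(X)$ is the usual automorphism group of $X$ and $\mathbb C(G(X))$ its algebra of complex functions. The canonical surjection $A(X)\to\mathbb C(G(X))$ sends $u_{ij}$ to the characteristic function of $\{\sigma\in G(X)\mid\sigma(j)=i\}$; its kernel is the commutator ideal. *)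

theory Defs
  imports
    "HOL-Analysis.Abstract_Metric_Spaces"
    "HOL-Algebra.Algebraic_Closure_Type"
    "HOL-Combinatorics.Permutations"
    "Graph_Theory.Graph_Theory"
begin

section \<open>Graphs\<close>

text \<open>
  Finite simple graphs are taken to be \<^locale>\<open>pair_graph\<close>s, that is, finite symmetric loop-free
  digraphs; an undirected edge is a pair of opposite arcs.
\<close>

definition K3 :: "nat pair_pre_digraph" where
  "K3 = \<lparr>pverts = {1, 2, 3}, parcs = {(i, j). i \<in> {1, 2, 3} \<and> j \<in> {1, 2, 3} \<and> i \<noteq> j}\<rparr>"

definition direct_product ::
  "'v pair_pre_digraph \<Rightarrow> 'w pair_pre_digraph \<Rightarrow> ('v \<times> 'w) pair_pre_digraph" where
  "direct_product G H =
    \<lparr>pverts = pverts G \<times> pverts H,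
     parcs = {((i, \<alpha>), (j, \<beta>)). (i, j) \<in> parcs G \<and> (\<alpha>, \<beta>) \<in> parcs H}\<rparr>"

definition cartesian_product ::
  "'v pair_pre_digraph \<Rightarrow> 'w pair_pre_digraph \<Rightarrow> ('v \<times> 'w) pair_pre_digraph" where
  "cartesian_product G H =
    \<lparr>pverts = pverts G \<times> pverts H,
     parcs = {((i, \<alpha>), (j, \<beta>)).
       i \<in> pverts G \<and> i = j \<and> (\<alpha>, \<beta>) \<in> parcs H \<or>
       (i, j) \<in> parcs G \<and> \<alpha> \<in> pverts H \<and> \<alpha> = \<beta>}\<rparr>"

text \<open>
  Automorphisms are taken to be the identity off the vertex set, so that the functions in
  \<open>graph_auts G\<close> correspond one-to-one to the elements of the automorphism group.
\<close>

definition graph_auts :: "'v pair_pre_digraph \<Rightarrow> ('v \<Rightarrow> 'v) set" where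
  "graph_auts G = {\<sigma>. \<sigma> permutes pverts G \<and>
     (\<forall>i\<in>pverts G. \<forall>j\<in>pverts G. (\<sigma> i, \<sigma> j) \<in> parcs G \<longleftrightarrow> (i, j) \<in> parcs G)}"

definition adjacency :: "'v pair_pre_digraph \<Rightarrow> 'v \<Rightarrow> 'v \<Rightarrow> complex" where
  "adjacency G i j = (if (i, j) \<in> parcs G then 1 else 0)"

lemma pair_graph_K3: "pair_graph K3"
proof -
  have "finite (parcs K3)"
    by (rule finite_subset[of _ "{1, 2, 3} \<times> {1, 2, 3}"]) (auto simp: K3_def)
  then show ?thesis
    by unfold_locales (auto simp: K3_def symmetric_def intro!: symI)
qed

lemma pair_graph_direct_product:
  assumes "pair_graph G" "pair_graph H"
  shows "pair_graph (direct_product G H)"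
proof -
  interpret G: pair_graph G by fact
  interpret H: pair_graph H by fact
  have sub: "parcs (direct_product G H) \<subseteq>
      (pverts G \<times> pverts H) \<times> (pverts G \<times> pverts H)"
    by (auto simp: direct_product_def dest: G.wellformed' H.wellformed')
  have fin: "finite (parcs (direct_product G H))"
    by (rule finite_subset[OF sub]) (simp add: G.pair_finite_verts H.pair_finite_verts)
  show ?thesis
    using G.pair_sym_arcs H.pair_sym_arcs fin
    by unfold_locales
      (auto simp: direct_product_def symmetric_def G.pair_finite_verts H.pair_finite_verts
        intro!: symI dest: G.wellformed' H.wellformed' G.pair_no_loops H.pair_no_loops symD)
qed

lemma pair_graph_cartesian_product:
  assumes "pair_graph G" "pair_graph H"
  shows "pair_graph (cartesian_product G H)"
proof -
  interpret G: pair_graph G by fact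
  interpret H: pair_graph H by fact
  have sub: "parcs (cartesian_product G H) \<subseteq>
      (pverts G \<times> pverts H) \<times> (pverts G \<times> pverts H)"
    by (auto simp: cartesian_product_def dest: G.wellformed' H.wellformed')
  have fin: "finite (parcs (cartesian_product G H))"
    by (rule finite_subset[OF sub]) (simp add: G.pair_finite_verts H.pair_finite_verts)
  show ?thesis
    using G.pair_sym_arcs H.pair_sym_arcs fin
    by unfold_locales
      (auto simp: cartesian_product_def symmetric_def G.pair_finite_verts H.pair_finite_verts
        intro!: symI dest: G.wellformed' H.wellformed' G.pair_no_loops H.pair_no_loops symD)
qed

section \<open>Unital C*-algebras\<close>

record 'a cstar_algebra = "(complex, 'a) module" +
  star :: "'a \<Rightarrow> 'a"
  cnorm :: "'a \<Rightarrow> real"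

text \<open>
  \<^locale>\<open>Metric_space\<close> requires nonnegativity and symmetry of the distance also off the carrier,
  hence the guard.
\<close>

definition cstar_dist :: "('a, 'm) cstar_algebra_scheme \<Rightarrow> 'a \<Rightarrow> 'a \<Rightarrow> real" where
  "cstar_dist A x y =
    (if x \<in> carrier A \<and> y \<in> carrier A then cnorm A (x \<ominus>\<^bsub>A\<^esub> y) else 0)"

text \<open>
  The library locale for algebras requires commutativity, so the two compatibility laws between
  scalars and multiplication are listed explicitly. The zero algebra is allowed.
\<close>

locale unital_cstar_algebra =
  ring A + module "ring_of_type_algebra :: complex ring" A
  for A :: "('a, 'm) cstar_algebra_scheme" (structure) +
  assumes smult_mult_left:
      "\<lbrakk>x \<in> carrier A; y \<in> carrier A\<rbrakk> \<Longrightarrow> (c \<odot> x) \<otimes> y = c \<odot> (x \<otimes> y)"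
    and smult_mult_right:
      "\<lbrakk>x \<in> carrier A; y \<in> carrier A\<rbrakk> \<Longrightarrow> x \<otimes> (c \<odot> y) = c \<odot> (x \<otimes> y)"
    and star_closed: "x \<in> carrier A \<Longrightarrow> star A x \<in> carrier A"
    and star_star: "x \<in> carrier A \<Longrightarrow> star A (star A x) = x"
    and star_add:
      "\<lbrakk>x \<in> carrier A; y \<in> carrier A\<rbrakk> \<Longrightarrow> star A (x \<oplus> y) = star A x \<oplus> star A y"
    and star_smult: "x \<in> carrier A \<Longrightarrow> star A (c \<odot> x) = cnj c \<odot> star A x"
    and star_mult:
      "\<lbrakk>x \<in> carrier A; y \<in> carrier A\<rbrakk> \<Longrightarrow> star A (x \<otimes> y) = star A y \<otimes> star A x"
    and cnorm_nonneg: "x \<in> carrier A \<Longrightarrow> 0 \<le> cnorm A x"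
    and cnorm_eq_zero: "x \<in> carrier A \<Longrightarrow> cnorm A x = 0 \<longleftrightarrow> x = \<zero>"
    and cnorm_triangle:
      "\<lbrakk>x \<in> carrier A; y \<in> carrier A\<rbrakk> \<Longrightarrow> cnorm A (x \<oplus> y) \<le> cnorm A x + cnorm A y"
    and cnorm_smult: "x \<in> carrier A \<Longrightarrow> cnorm A (c \<odot> x) = cmod c * cnorm A x"
    and cnorm_mult:
      "\<lbrakk>x \<in> carrier A; y \<in> carrier A\<rbrakk> \<Longrightarrow> cnorm A (x \<otimes> y) \<le> cnorm A x * cnorm A y"
    and cstar_identity: "x \<in> carrier A \<Longrightarrow> cnorm A (star A x \<otimes> x) = (cnorm A x)\<^sup>2"
    and complete: "Metric_space.mcomplete (carrier A) (cstar_dist A)"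

definition cstar_hom ::
  "('a, 'm) cstar_algebra_scheme \<Rightarrow> ('b, 'n) cstar_algebra_scheme \<Rightarrow> ('a \<Rightarrow> 'b) set" where
  "cstar_hom A B = {\<phi> \<in> ring_hom A B.
     (\<forall>c. \<forall>x\<in>carrier A. \<phi> (c \<odot>\<^bsub>A\<^esub> x) = c \<odot>\<^bsub>B\<^esub> \<phi> x) \<and>
     (\<forall>x\<in>carrier A. \<phi> (star A x) = star B (\<phi> x))}"

definition cstar_iso ::
  "('a, 'm) cstar_algebra_scheme \<Rightarrow> ('b, 'n) cstar_algebra_scheme \<Rightarrow> ('a \<Rightarrow> 'b) set" where
  "cstar_iso A B = {\<phi> \<in> cstar_hom A B. bij_betw \<phi> (carrier A) (carrier B)}"

definition cstar_subalgebra :: "('a, 'm) cstar_algebra_scheme \<Rightarrow> 'a set \<Rightarrow> bool" where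
  "cstar_subalgebra A S \<longleftrightarrow>
     closedin (Metric_space.mtopology (carrier A) (cstar_dist A)) S \<and>
     \<one>\<^bsub>A\<^esub> \<in> S \<and>
     (\<forall>x\<in>S. \<forall>y\<in>S. x \<oplus>\<^bsub>A\<^esub> y \<in> S \<and> x \<otimes>\<^bsub>A\<^esub> y \<in> S) \<and>
     (\<forall>c. \<forall>x\<in>S. c \<odot>\<^bsub>A\<^esub> x \<in> S) \<and>
     (\<forall>x\<in>S. star A x \<in> S)"

definition cstar_generated :: "('a, 'm) cstar_algebra_scheme \<Rightarrow> 'a set \<Rightarrow> bool" where
  "cstar_generated A E \<longleftrightarrow>
     E \<subseteq> carrier A \<and> (\<forall>S. cstar_subalgebra A S \<and> E \<subseteq> S \<longrightarrow> S = carrier A)"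

section \<open>Magic unitaries and the algebra of a graph\<close>

definition projection :: "('a, 'm) cstar_algebra_scheme \<Rightarrow> 'a \<Rightarrow> bool" where
  "projection A p \<longleftrightarrow> p \<in> carrier A \<and> p \<otimes>\<^bsub>A\<^esub> p = p \<and> star A p = p"

definition magic_unitary ::
  "('a, 'm) cstar_algebra_scheme \<Rightarrow> 'v set \<Rightarrow> ('v \<Rightarrow> 'v \<Rightarrow> 'a) \<Rightarrow> bool" where
  "magic_unitary A V u \<longleftrightarrow>
     (\<forall>i\<in>V. \<forall>j\<in>V. projection A (u i j)) \<and>
     (\<forall>i\<in>V. \<forall>j\<in>V. \<forall>k\<in>V. j \<noteq> k \<longrightarrow> u i j \<otimes>\<^bsub>A\<^esub> u i k = \<zero>\<^bsub>A\<^esub>) \<and>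
     (\<forall>i\<in>V. \<forall>j\<in>V. \<forall>k\<in>V. j \<noteq> k \<longrightarrow> u j i \<otimes>\<^bsub>A\<^esub> u k i = \<zero>\<^bsub>A\<^esub>) \<and>
     (\<forall>i\<in>V. (\<Oplus>\<^bsub>A\<^esub>j\<in>V. u i j) = \<one>\<^bsub>A\<^esub>) \<and>
     (\<forall>i\<in>V. (\<Oplus>\<^bsub>A\<^esub>j\<in>V. u j i) = \<one>\<^bsub>A\<^esub>)"

text \<open>The last conjunct is the matrix equation \<open>du = ud\<close>, entry by entry.\<close>

definition graph_magic_unitary ::
  "'v pair_pre_digraph \<Rightarrow> ('a, 'm) cstar_algebra_scheme \<Rightarrow> ('v \<Rightarrow> 'v \<Rightarrow> 'a) \<Rightarrow> bool" where
  "graph_magic_unitary G A u \<longleftrightarrow>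
     magic_unitary A (pverts G) u \<and>
     (\<forall>i\<in>pverts G. \<forall>j\<in>pverts G.
        (\<Oplus>\<^bsub>A\<^esub>k\<in>pverts G. adjacency G i k \<odot>\<^bsub>A\<^esub> u k j) =
        (\<Oplus>\<^bsub>A\<^esub>k\<in>pverts G. adjacency G k j \<odot>\<^bsub>A\<^esub> u i k))"

text \<open>
  \<open>A\<close> with generators \<open>u\<close> is the universal unital C*-algebra of the graph \<open>G\<close>. HOL cannot quantify
  over all types, so the test algebras \<open>B\<close> of the universal property have their carriers inside
  \<open>nat \<Rightarrow> complex\<close>. Nothing is lost: for arbitrary \<open>B\<close> the universal property only involves the
  C*-subalgebra generated by the finitely many \<open>v i j\<close>, which is separable, hence has at most
  continuum many elements and an isomorphic copy with carrier inside \<open>nat \<Rightarrow> complex\<close>. The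
  homomorphism \<open>\<phi>\<close> is unique on the carrier because \<open>A\<close> is generated by the \<open>u i j\<close> and
  *-homomorphisms are continuous.
\<close>

definition is_quantum_aut_algebra ::
  "'v pair_pre_digraph \<Rightarrow> ('a, 'm) cstar_algebra_scheme \<Rightarrow> ('v \<Rightarrow> 'v \<Rightarrow> 'a) \<Rightarrow> bool" where
  "is_quantum_aut_algebra G A u \<longleftrightarrow>
     unital_cstar_algebra A \<and>
     graph_magic_unitary G A u \<and>
     cstar_generated A {u i j | i j. i \<in> pverts G \<and> j \<in> pverts G} \<and>
     (\<forall>(B :: (nat \<Rightarrow> complex) cstar_algebra) v.
        unital_cstar_algebra B \<and> graph_magic_unitary G B v \<longrightarrow>
        (\<exists>\<phi>\<in>cstar_hom A B. \<forall>i\<in>pverts G. \<forall>j\<in>pverts G. \<phi> (u i j) = v i j))"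

section \<open>The canonical surjection\<close>

definition function_algebra :: "'s set \<Rightarrow> ('s \<Rightarrow> complex) cstar_algebra" where
  "function_algebra S =
    \<lparr>carrier = S \<rightarrow>\<^sub>E UNIV,
     monoid.mult = (\<lambda>f g. \<lambda>s\<in>S. f s * g s), one = (\<lambda>s\<in>S. 1),
     zero = (\<lambda>s\<in>S. 0), add = (\<lambda>f g. \<lambda>s\<in>S. f s + g s),
     module.smult = (\<lambda>c f. \<lambda>s\<in>S. c * f s),
     star = (\<lambda>f. \<lambda>s\<in>S. cnj (f s)),
     cnorm = (\<lambda>f. SUP s\<in>S. cmod (f s))\<rparr>"

text \<open>
  The supremum in \<open>cnorm\<close> is meaningful for finite nonempty \<open>S\<close>, which covers automorphism groups
  of finite graphs.
\<close>

lemma unital_cstar_algebra_function_algebra: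
  assumes fin: "finite S" and ne: "S \<noteq> {}"
  shows "unital_cstar_algebra (function_algebra S)" (is "unital_cstar_algebra ?A")
proof -
  have carr: "carrier ?A = S \<rightarrow>\<^sub>E UNIV" by (simp add: function_algebra_def)
  have ext: "f \<in> S \<rightarrow>\<^sub>E UNIV \<Longrightarrow> (\<lambda>s\<in>S. f s) = f" for f :: "'a \<Rightarrow> complex"
    by (auto simp: fun_eq_iff PiE_def extensional_def)
  have grp: "abelian_group ?A"
  proof (rule abelian_groupI)
    fix f assume f: "f \<in> carrier ?A"
    show "\<exists>g\<in>carrier ?A. g \<oplus>\<^bsub>?A\<^esub> f = \<zero>\<^bsub>?A\<^esub>"
      by (rule bexI[of _ "\<lambda>s\<in>S. - f s"]) (auto simp: function_algebra_def)
  qed (auto simp: function_algebra_def fun_eq_iff PiE_def extensional_def)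
  have rng: "ring ?A"
    by (rule ringI[OF grp monoidI])
      (auto simp: function_algebra_def fun_eq_iff PiE_def extensional_def algebra_simps)
  have mdl: "module (ring_of_type_algebra :: complex ring) ?A"
    by (rule moduleI[OF cring_from_type_algebra grp])
      (auto simp: ring_of_type_algebra_def function_algebra_def fun_eq_iff PiE_def
        extensional_def algebra_simps)
  have nrm: "cnorm ?A f = Max ((\<lambda>s. cmod (f s)) ` S)" for f
    using fin ne by (simp add: function_algebra_def cSup_eq_Max)
  have le: "cnorm ?A f \<le> r \<longleftrightarrow> (\<forall>s\<in>S. cmod (f s) \<le> r)" for f r
    unfolding nrm using fin ne by simp
  have less: "cnorm ?A f < r \<longleftrightarrow> (\<forall>s\<in>S. cmod (f s) < r)" for f r
    unfolding nrm using fin ne by simp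
  have ge: "s \<in> S \<Longrightarrow> cmod (f s) \<le> cnorm ?A f" for f s
    using le by blast
  have att: "\<exists>s\<in>S. cnorm ?A f = cmod (f s)" for f
  proof -
    have "Max ((\<lambda>s. cmod (f s)) ` S) \<in> (\<lambda>s. cmod (f s)) ` S"
      using fin ne by (intro Max_in) auto
    then show ?thesis unfolding nrm by auto
  qed
  have nn: "0 \<le> cnorm ?A f" for f
    using att[of f] by auto
  have z: "cnorm ?A f = 0 \<longleftrightarrow> (\<forall>s\<in>S. f s = 0)" for f
    using le[of f 0] nn[of f] by force
  interpret R: ring ?A by fact
  have minus: "f \<ominus>\<^bsub>?A\<^esub> g = (\<lambda>s\<in>S. f s - g s)" if "f \<in> carrier ?A" "g \<in> carrier ?A" for f g
  proof -
    have "(\<lambda>s\<in>S. - g s) \<oplus>\<^bsub>?A\<^esub> g = \<zero>\<^bsub>?A\<^esub>" "(\<lambda>s\<in>S. - g s) \<in> carrier ?A"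
      by (auto simp: function_algebra_def)
    then have "\<ominus>\<^bsub>?A\<^esub> g = (\<lambda>s\<in>S. - g s)"
      using that R.minus_equality by blast
    then show ?thesis
      by (auto simp: a_minus_def) (auto simp: function_algebra_def)
  qed
  have dist: "cstar_dist ?A f g = cnorm ?A (\<lambda>s\<in>S. f s - g s)"
    if "f \<in> carrier ?A" "g \<in> carrier ?A" for f g
    using that by (simp add: cstar_dist_def minus)
  have distless: "cstar_dist ?A f g < r \<longleftrightarrow> (\<forall>s\<in>S. cmod (f s - g s) < r)"
    if "f \<in> carrier ?A" "g \<in> carrier ?A" for f g r
    using that by (simp add: dist less)
  have ms: "Metric_space (carrier ?A) (cstar_dist ?A)"
  proof
    fix f g h
    show "0 \<le> cstar_dist ?A f g" by (simp add: cstar_dist_def nn)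
    show "cstar_dist ?A f g = cstar_dist ?A g f"
      using ne by (auto simp: cstar_dist_def minus nrm norm_minus_commute cong: image_cong_simp)
    assume f: "f \<in> carrier ?A" and g: "g \<in> carrier ?A"
    show "cstar_dist ?A f g = 0 \<longleftrightarrow> f = g"
      using f g by (auto simp: dist z carr intro: PiE_ext)
    assume h: "h \<in> carrier ?A"
    have "cmod (f s - h s) \<le> cstar_dist ?A f g + cstar_dist ?A g h" if "s \<in> S" for s
    proof -
      have "cmod (f s - h s) \<le> cmod (f s - g s) + cmod (g s - h s)"
        using norm_triangle_ineq[of "f s - g s" "g s - h s"] by simp
      also have "\<dots> \<le> cstar_dist ?A f g + cstar_dist ?A g h"
        using ge[OF that, of "\<lambda>s\<in>S. f s - g s"] ge[OF that, of "\<lambda>s\<in>S. g s - h s"] that f g h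
        by (simp add: dist)
      finally show ?thesis .
    qed
    then show "cstar_dist ?A f h \<le> cstar_dist ?A f g + cstar_dist ?A g h"
      using f h by (simp add: dist[of f h] le)
  qed
  interpret M: Metric_space "carrier ?A" "cstar_dist ?A" by fact
  have comp: "M.mcomplete"
    unfolding M.mcomplete_def
  proof (intro allI impI)
    fix \<sigma> assume c: "M.MCauchy \<sigma>"
    then have \<sigma>: "\<sigma> n \<in> carrier ?A" for n by (auto simp: M.MCauchy_def)
    have "Cauchy (\<lambda>n. \<sigma> n s)" if "s \<in> S" for s
    proof (rule CauchyI)
      fix e :: real assume "0 < e"
      then obtain N where "\<forall>m n. N \<le> m \<longrightarrow> N \<le> n \<longrightarrow> cstar_dist ?A (\<sigma> m) (\<sigma> n) < e"
        using c unfolding M.MCauchy_def by blast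
      then show "\<exists>M. \<forall>m\<ge>M. \<forall>n\<ge>M. cmod (\<sigma> m s - \<sigma> n s) < e"
        using that \<sigma> by (auto simp: distless dist_norm)
    qed
    then have "\<forall>s\<in>S. \<exists>l. (\<lambda>n. \<sigma> n s) \<longlonglongrightarrow> l"
      using Cauchy_convergent convergent_def by blast
    then obtain l where l: "\<And>s. s \<in> S \<Longrightarrow> (\<lambda>n. \<sigma> n s) \<longlonglongrightarrow> l s" by metis
    have lc: "(\<lambda>s\<in>S. l s) \<in> carrier ?A" by (simp add: carr)
    have "\<forall>\<^sub>F n in sequentially. cstar_dist ?A (\<sigma> n) (\<lambda>s\<in>S. l s) < e" if "0 < e" for e
    proof -
      have "\<forall>\<^sub>F n in sequentially. cmod (\<sigma> n s - l s) < e" if "s \<in> S" for s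
        using tendstoD[OF l[OF that] \<open>0 < e\<close>] by (simp add: dist_norm)
      then have "\<forall>\<^sub>F n in sequentially. \<forall>s\<in>S. cmod (\<sigma> n s - l s) < e"
        using fin by (simp add: eventually_ball_finite)
      then show ?thesis
        by (rule eventually_mono) (use \<sigma> lc in \<open>simp add: distless\<close>)
    qed
    then show "\<exists>x. limitin M.mtopology \<sigma> x sequentially"
      using lc \<sigma> by (auto simp: M.limitin_metric intro!: exI[of _ "\<lambda>s\<in>S. l s"])
  qed
  have simps: "f \<otimes>\<^bsub>?A\<^esub> g = (\<lambda>s\<in>S. f s * g s)" "f \<oplus>\<^bsub>?A\<^esub> g = (\<lambda>s\<in>S. f s + g s)"
    "c \<odot>\<^bsub>?A\<^esub> f = (\<lambda>s\<in>S. c * f s)" "star ?A f = (\<lambda>s\<in>S. cnj (f s))"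
    "\<zero>\<^bsub>?A\<^esub> = (\<lambda>s\<in>S. 0)" for f g c
    by (simp_all add: function_algebra_def)
  show ?thesis
  proof (intro unital_cstar_algebra.intro unital_cstar_algebra_axioms.intro rng mdl comp nn)
    fix f g :: "'a \<Rightarrow> complex" and c :: complex
    assume f: "f \<in> carrier ?A"
    show "star ?A (star ?A f) = f" using f ext by (auto simp: simps carr cong: restrict_cong)
    show "star ?A (c \<odot>\<^bsub>?A\<^esub> f) = cnj c \<odot>\<^bsub>?A\<^esub> star ?A f" by (auto simp: simps)
    show "star ?A f \<in> carrier ?A" by (simp add: simps carr)
    show "cnorm ?A f = 0 \<longleftrightarrow> f = \<zero>\<^bsub>?A\<^esub>"
      using f by (auto simp: z simps carr fun_eq_iff PiE_def extensional_def)
    obtain s where s: "s \<in> S" "cnorm ?A f = cmod (f s)" using att by blast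
    show "cnorm ?A (c \<odot>\<^bsub>?A\<^esub> f) = cmod c * cnorm ?A f"
    proof (rule antisym)
      show "cnorm ?A (c \<odot>\<^bsub>?A\<^esub> f) \<le> cmod c * cnorm ?A f"
        using ge[of _ f] by (auto simp: le simps norm_mult intro: mult_left_mono)
      show "cmod c * cnorm ?A f \<le> cnorm ?A (c \<odot>\<^bsub>?A\<^esub> f)"
        using ge[OF s(1), of "c \<odot>\<^bsub>?A\<^esub> f"] s by (simp add: simps norm_mult)
    qed
    show "cnorm ?A (star ?A f \<otimes>\<^bsub>?A\<^esub> f) = (cnorm ?A f)\<^sup>2"
    proof (rule antisym)
      show "cnorm ?A (star ?A f \<otimes>\<^bsub>?A\<^esub> f) \<le> (cnorm ?A f)\<^sup>2"
        using ge[of _ f] by (auto simp: le simps norm_mult power2_eq_square intro!: mult_mono nn)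
      show "(cnorm ?A f)\<^sup>2 \<le> cnorm ?A (star ?A f \<otimes>\<^bsub>?A\<^esub> f)"
        using ge[OF s(1), of "star ?A f \<otimes>\<^bsub>?A\<^esub> f"] s
        by (simp add: simps norm_mult power2_eq_square)
    qed
    assume g: "g \<in> carrier ?A"
    show "star ?A (f \<oplus>\<^bsub>?A\<^esub> g) = star ?A f \<oplus>\<^bsub>?A\<^esub> star ?A g"
      "star ?A (f \<otimes>\<^bsub>?A\<^esub> g) = star ?A g \<otimes>\<^bsub>?A\<^esub> star ?A f"
      "(c \<odot>\<^bsub>?A\<^esub> f) \<otimes>\<^bsub>?A\<^esub> g = c \<odot>\<^bsub>?A\<^esub> (f \<otimes>\<^bsub>?A\<^esub> g)"
      "f \<otimes>\<^bsub>?A\<^esub> (c \<odot>\<^bsub>?A\<^esub> g) = c \<odot>\<^bsub>?A\<^esub> (f \<otimes>\<^bsub>?A\<^esub> g)"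
      by (auto simp: simps algebra_simps)
    show "cnorm ?A (f \<oplus>\<^bsub>?A\<^esub> g) \<le> cnorm ?A f + cnorm ?A g"
      using ge[of _ f] ge[of _ g]
      by (auto simp: le simps intro!: order_trans[OF norm_triangle_ineq] add_mono)
    show "cnorm ?A (f \<otimes>\<^bsub>?A\<^esub> g) \<le> cnorm ?A f * cnorm ?A g"
      using ge[of _ f] ge[of _ g] by (auto simp: le simps norm_mult intro!: mult_mono nn)
  qed
qed

lemma finite_graph_auts: "finite (pverts G) \<Longrightarrow> finite (graph_auts G)"
  by (rule finite_subset[OF _ finite_permutations[of "pverts G"]]) (auto simp: graph_auts_def)

lemma id_in_graph_auts: "id \<in> graph_auts G"
  by (simp add: graph_auts_def permutes_id)

lemma unital_cstar_algebra_function_algebra_graph_auts: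
  "pair_graph G \<Longrightarrow> unital_cstar_algebra (function_algebra (graph_auts G))"
  using id_in_graph_auts[of G] pair_fin_digraph.pair_finite_verts[of G]
  by (intro unital_cstar_algebra_function_algebra finite_graph_auts)
    (auto simp: pair_graph_def pair_digraph_def)

definition is_canonical_surjection ::
  "'v pair_pre_digraph \<Rightarrow> ('a, 'm) cstar_algebra_scheme \<Rightarrow> ('v \<Rightarrow> 'v \<Rightarrow> 'a) \<Rightarrow>
   ('a \<Rightarrow> (('v \<Rightarrow> 'v) \<Rightarrow> complex)) \<Rightarrow> bool" where
  "is_canonical_surjection G A u \<phi> \<longleftrightarrow>
     \<phi> \<in> cstar_hom A (function_algebra (graph_auts G)) \<and>
     (\<forall>i\<in>pverts G. \<forall>j\<in>pverts G.
        \<phi> (u i j) = (\<lambda>\<sigma>\<in>graph_auts G. if \<sigma> j = i then 1 else 0))"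

text \<open>
  \<open>u\<close> generate \<open>A\<close>, so they determine the canonical surjection uniquely on the
  carrier of \<open>A\<close>; its surjectivity is part of being an isomorphism.
\<close>

definition no_quantum_symmetry ::
  "'v pair_pre_digraph \<Rightarrow> ('a, 'm) cstar_algebra_scheme \<Rightarrow> ('v \<Rightarrow> 'v \<Rightarrow> 'a) \<Rightarrow> bool" where
  "no_quantum_symmetry G A u \<longleftrightarrow>
     (\<exists>\<phi>. is_canonical_surjection G A u \<phi> \<and>
          \<phi> \<in> cstar_iso A (function_algebra (graph_auts G)))"

end

theory Submission
  imports Defs
begin

text \<open>
  In the torus and in its complement every two adjacent vertices have exactly one common neighbour.
  Hence for adjacent \<open>i, k\<close> with common neighbour \<open>m\<close> and adjacent \<open>j, l\<close> with common neighbour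
  \<open>n\<close>, inserting \<open>1 = (\<Sum>r. u m r)\<close> yields \<open>u i j \<cdot> u k l = u i j \<cdot> u m n \<cdot> u k l\<close>, in whichever order
  the three pairs are taken. Three projections with this property commute, so the entries of \<open>u\<close>
  commute. Their products \<open>p \<sigma> = (\<Prod>j. u (\<sigma> j) j)\<close> then vanish unless \<open>\<sigma>\<close> is an automorphism, only
  \<open>0\<close> is annihilated by all of them, and every element of \<open>A\<close> acts on \<open>p \<sigma>\<close> by a scalar, because the
  elements doing so form a C*-subalgebra containing all \<open>u i j\<close>. The scalar is the value at \<open>\<sigma>\<close> of the
  image under the canonical surjection.
\<close>

section \<open>Unital C*-algebras\<close>

lemma (in abelian_monoid) finsum_single:
  assumes "finite V" "k \<in> V" "f \<in> V \<rightarrow> carrier G"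
    and "\<And>i. i \<in> V \<Longrightarrow> i \<noteq> k \<Longrightarrow> f i = \<zero>"
  shows "(\<Oplus>i\<in>V. f i) = f k"
proof -
  have "(\<Oplus>i\<in>V. f i) = (\<Oplus>i\<in>V. if k = i then f i else \<zero>)"
    by (rule finsum_cong') (use assms in auto)
  also have "\<dots> = f k"
    using assms by (intro add.finprod_singleton) auto
  finally show ?thesis .
qed

text \<open>
  In \<^locale>\<open>unital_cstar_algebra\<close> unqualified facts such as \<open>m_assoc\<close> are about the ring of scalars;
  the qualifier \<open>A\<close> makes those about the algebra accessible.
\<close>
locale cstar_algebra_with_ring_facts = A: ring A + unital_cstar_algebra A
  for A :: "('a, 'm) cstar_algebra_scheme" (structure)
begin

lemma scalar_simps [simp]:
  "carrier (ring_of_type_algebra :: complex ring) = UNIV"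
  "\<zero>\<^bsub>(ring_of_type_algebra :: complex ring)\<^esub> = 0"
  "\<one>\<^bsub>(ring_of_type_algebra :: complex ring)\<^esub> = 1"
  "c \<oplus>\<^bsub>(ring_of_type_algebra :: complex ring)\<^esub> d = c + d"
  "c \<otimes>\<^bsub>(ring_of_type_algebra :: complex ring)\<^esub> d = c * d"
  by (simp_all add: ring_of_type_algebra_def)

section \<open>Scalar multiples, differences and the norm\<close>

lemma smult_simps:
  assumes "x \<in> carrier A"
  shows "c \<odot> x \<in> carrier A" "0 \<odot> x = \<zero>" "1 \<odot> x = x" "(c * d) \<odot> x = c \<odot> (d \<odot> x)"
    "(c + d) \<odot> x = c \<odot> x \<oplus> d \<odot> x"
  using assms smult_closed[of c x] smult_l_null[of x] smult_one[of x] smult_assoc1[of c d x]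
    smult_l_distr[of c d x]
  by simp_all

lemma smult_zero_right: "c \<odot> \<zero> = \<zero>"
  using smult_r_null[of c] by simp

lemma minus_eq_smult:
  assumes "x \<in> carrier A"
  shows "\<ominus> x = (- 1) \<odot> x"
proof (rule A.minus_equality)
  have "(- 1) \<odot> x \<oplus> x = (- 1 + 1) \<odot> x"
    using assms smult_simps(5)[of x "- 1" 1] by (simp add: smult_simps)
  then show "(- 1) \<odot> x \<oplus> x = \<zero>" using assms by (simp add: smult_simps)
qed (use assms smult_simps in auto)

lemma diff_eq_smult: "x \<in> carrier A \<Longrightarrow> y \<in> carrier A \<Longrightarrow> x \<ominus> y = x \<oplus> (- 1) \<odot> y"
  by (simp add: a_minus_def minus_eq_smult)

lemma star_diff:
  assumes "x \<in> carrier A" "y \<in> carrier A"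
  shows "star A (x \<ominus> y) = star A x \<ominus> star A y"
  using assms by (simp add: diff_eq_smult star_add star_smult star_closed smult_simps)

lemma smult_diff_left:
  assumes "x \<in> carrier A"
  shows "c \<odot> x \<ominus> d \<odot> x = (c - d) \<odot> x"
proof -
  have "(c - d) \<odot> x = (c + (- 1) * d) \<odot> x" by simp
  also have "\<dots> = c \<odot> x \<oplus> (- 1) \<odot> (d \<odot> x)" using assms by (simp only: smult_simps)
  finally show ?thesis using assms by (simp add: diff_eq_smult smult_simps)
qed

lemma cnorm_zero: "cnorm A \<zero> = 0"
  by (simp add: cnorm_eq_zero)

lemma cnorm_minus: "x \<in> carrier A \<Longrightarrow> cnorm A (\<ominus> x) = cnorm A x"
  by (simp add: minus_eq_smult cnorm_smult)

lemma cnorm_diff_commute: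
  assumes "x \<in> carrier A" "y \<in> carrier A"
  shows "cnorm A (x \<ominus> y) = cnorm A (y \<ominus> x)"
proof -
  have "x \<ominus> y = \<ominus> (y \<ominus> x)"
    using assms by (simp add: a_minus_def A.minus_add A.a_comm)
  then show ?thesis using assms by (simp add: cnorm_minus)
qed

lemma diff_add_diff:
  assumes "x \<in> carrier A" "y \<in> carrier A" "z \<in> carrier A"
  shows "(x \<ominus> y) \<oplus> (y \<ominus> z) = x \<ominus> z"
  using assms by (simp add: a_minus_def A.a_assoc A.r_neg1)

lemma diff_mult_distr:
  assumes "x \<in> carrier A" "y \<in> carrier A" "z \<in> carrier A"
  shows "(x \<ominus> y) \<otimes> z = x \<otimes> z \<ominus> y \<otimes> z"
  using assms by (simp add: a_minus_def A.l_distr A.l_minus)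

lemma mult_diff_distr:
  assumes "x \<in> carrier A" "y \<in> carrier A" "z \<in> carrier A"
  shows "z \<otimes> (x \<ominus> y) = z \<otimes> x \<ominus> z \<otimes> y"
  using assms by (simp add: a_minus_def A.r_distr A.r_minus)

lemma diff_eq_zero_iff:
  "x \<in> carrier A \<Longrightarrow> y \<in> carrier A \<Longrightarrow> x \<ominus> y = \<zero> \<longleftrightarrow> x = y"
  by (metis A.r_right_minus_eq)

text \<open>By the C*-identity the square of the norm of \<open>y\<close> is at most the product of
  the norms of \<open>star A y\<close> and \<open>y\<close>. Cancelling one factor gives one
  inequality, and applying it to \<open>star A x\<close> gives the other.\<close>

lemma cnorm_star:
  assumes "x \<in> carrier A"
  shows "cnorm A (star A x) = cnorm A x"
proof -
  have le: "cnorm A y \<le> cnorm A (star A y)" if y: "y \<in> carrier A" for y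
  proof (cases "cnorm A y = 0")
    case False
    have "cnorm A y * cnorm A y \<le> cnorm A (star A y) * cnorm A y"
      using cstar_identity[OF y] cnorm_mult[OF star_closed[OF y] y] by (simp add: power2_eq_square)
    then show ?thesis using False cnorm_nonneg[OF y] by simp
  qed (use y star_closed cnorm_nonneg in auto)
  show ?thesis
    using le[OF assms] le[OF star_closed[OF assms]] star_star[OF assms] by simp
qed

text \<open>The completeness axiom speaks of \<open>cstar_dist\<close> without asserting that it is
  a metric. The norm axioms supply this and make limits and closed sets available.\<close>

sublocale M: Metric_space "carrier A" "cstar_dist A"
proof
  fix x y z
  show "0 \<le> cstar_dist A x y" by (simp add: cstar_dist_def cnorm_nonneg)
  show "cstar_dist A x y = cstar_dist A y x" by (simp add: cstar_dist_def cnorm_diff_commute)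
  assume x: "x \<in> carrier A" and y: "y \<in> carrier A"
  show "cstar_dist A x y = 0 \<longleftrightarrow> x = y"
    using x y by (simp add: cstar_dist_def cnorm_eq_zero diff_eq_zero_iff)
  assume z: "z \<in> carrier A"
  show "cstar_dist A x z \<le> cstar_dist A x y + cstar_dist A y z"
    using x y z cnorm_triangle[of "x \<ominus> y" "y \<ominus> z"] by (simp add: cstar_dist_def diff_add_diff)
qed

section \<open>Commuting projections\<close>

text \<open>The element \<open>e = (1 - x)yx\<close> has
  \<open>star A e \<otimes> e = xyx - xyxyx\<close>, which vanishes by idempotency, so
  \<open>e = 0\<close> by the C*-identity. Thus \<open>yx = xyx\<close>, and taking adjoints gives
  \<open>xy = xyx\<close> too.\<close>

lemma projections_commute:
  assumes x: "projection A x" and y: "projection A y"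
    and idem: "(x \<otimes> y \<otimes> x) \<otimes> (x \<otimes> y \<otimes> x) = x \<otimes> y \<otimes> x"
  shows "x \<otimes> y = y \<otimes> x"
proof -
  have c: "x \<in> carrier A" "y \<in> carrier A" and xx: "x \<otimes> x = x" and yy: "y \<otimes> y = y"
    and s: "star A x = x" "star A y = y"
    using x y by (auto simp: projection_def)
  have xx': "x \<otimes> (x \<otimes> z) = x \<otimes> z" and yy': "y \<otimes> (y \<otimes> z) = y \<otimes> z" if "z \<in> carrier A" for z
    using that c by (simp_all flip: A.m_assoc add: xx yy)
  have idem': "x \<otimes> (y \<otimes> (x \<otimes> (y \<otimes> x))) = x \<otimes> (y \<otimes> x)"
    using idem c by (simp add: A.m_assoc xx')
  define e where "e = y \<otimes> x \<ominus> x \<otimes> (y \<otimes> x)"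
  have e: "e \<in> carrier A" using c by (simp add: e_def)
  have "star A e = x \<otimes> y \<ominus> x \<otimes> (y \<otimes> x)"
    using c by (simp add: e_def star_diff star_mult s A.m_assoc)
  then have "star A e \<otimes> e = \<zero>"
    using c by (simp add: e_def diff_mult_distr mult_diff_distr A.m_assoc xx' yy' idem' xx yy
        diff_eq_zero_iff)
  then have "cnorm A e = 0" using cstar_identity[OF e] by (simp add: cnorm_zero)
  then have "y \<otimes> x = x \<otimes> (y \<otimes> x)"
    using c by (simp add: cnorm_eq_zero[OF e]) (simp add: e_def diff_eq_zero_iff)
  moreover have "star A (y \<otimes> x) = x \<otimes> y" "star A (x \<otimes> (y \<otimes> x)) = x \<otimes> (y \<otimes> x)"
    using c by (simp_all add: star_mult s A.m_assoc)
  ultimately show ?thesis by metis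
qed

text \<open>
  The hypotheses give \<open>xzx\<cdot>xyx = xyx\<close> and \<open>xyx\<cdot>xzx = xzx\<close>; since \<open>xyx\<close> and \<open>xzx\<close> are
  self-adjoint, they coincide and are idempotent.
\<close>
lemma projections_commute_if_triangle:
  assumes x: "projection A x" and y: "projection A y" and z: "projection A z"
    and "x \<otimes> y = x \<otimes> z \<otimes> y" "x \<otimes> z = x \<otimes> y \<otimes> z"
    and "y \<otimes> z = y \<otimes> x \<otimes> z" "z \<otimes> y = z \<otimes> x \<otimes> y"
  shows "x \<otimes> y = y \<otimes> x"
proof -
  have c: "x \<in> carrier A" "y \<in> carrier A" "z \<in> carrier A"
    and xx: "x \<otimes> x = x" and s: "star A x = x" "star A y = y" "star A z = z"
    using x y z by (auto simp: projection_def)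
  have xx': "x \<otimes> (x \<otimes> w) = x \<otimes> w" if "w \<in> carrier A" for w
    using that c by (simp flip: A.m_assoc add: xx)
  \<comment> \<open>Contract \<open>z \<otimes> x \<otimes> y\<close> to
    \<open>z \<otimes> y\<close> and then \<open>x \<otimes> z \<otimes> y\<close> to
    \<open>x \<otimes> y\<close>; likewise with \<open>y\<close> and \<open>z\<close>
    exchanged.\<close>
  have xzxy: "x \<otimes> (z \<otimes> (x \<otimes> y)) = x \<otimes> y" and xyxz: "x \<otimes> (y \<otimes> (x \<otimes> z)) = x \<otimes> z"
    using assms(4-7) c by (metis A.m_assoc A.m_closed)+
  let ?b = "x \<otimes> y \<otimes> x" and ?c = "x \<otimes> z \<otimes> x"
  have bc: "?b \<in> carrier A" "?c \<in> carrier A" using c by auto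
  have "?c \<otimes> ?b = (x \<otimes> (z \<otimes> (x \<otimes> y))) \<otimes> x" using c by (simp add: A.m_assoc xx')
  then have cb: "?c \<otimes> ?b = ?b" using xzxy by simp
  have "?b \<otimes> ?c = (x \<otimes> (y \<otimes> (x \<otimes> z))) \<otimes> x" using c by (simp add: A.m_assoc xx')
  then have bc': "?b \<otimes> ?c = ?c" using xyxz by simp
  have "star A ?b = ?b" "star A ?c = ?c" using c by (simp_all add: star_mult s A.m_assoc)
  then have "?b \<otimes> ?c = ?b" using cb star_mult[OF bc(2,1)] by simp
  then have "?b = ?c" using bc' by simp
  then show ?thesis using cb projections_commute[OF x y] by simp
qed

section \<open>Elements acting by a scalar on a fixed element\<close>

text \<open>
  For \<open>p\<close> an atom of a commutative algebra the scalars \<open>c\<close> are the values of a character.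
\<close>
definition scalar_on :: "'a \<Rightarrow> 'a set" where
  "scalar_on p = {x \<in> carrier A. \<exists>c. x \<otimes> p = c \<odot> p \<and> star A x \<otimes> p = cnj c \<odot> p}"

text \<open>For \<open>p \<noteq> \<zero>\<close> the scalars of a convergent sequence are at most
  as far apart as its members, hence Cauchy, and both defining equations pass to the limit. The
  element \<open>\<zero>\<close> determines no scalar, but there every element qualifies.\<close>

lemma closedin_scalar_on:
  assumes p: "p \<in> carrier A"
  shows "closedin M.mtopology (scalar_on p)"
proof (cases "p = \<zero>")
  case True
  then have "scalar_on p = carrier A"
    by (auto simp: scalar_on_def smult_zero_right star_closed)
  then show ?thesis using closedin_topspace[of M.mtopology] by simp
next
  case False
  then have pos: "0 < cnorm A p" using cnorm_nonneg[OF p] cnorm_eq_zero[OF p] by linarith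
  show ?thesis
    unfolding M.metric_closedin_iff_sequentially_closed
  proof (intro conjI allI impI)
    show "scalar_on p \<subseteq> carrier A" by (auto simp: scalar_on_def)
    fix \<sigma> l assume "range \<sigma> \<subseteq> scalar_on p \<and> limitin M.mtopology \<sigma> l sequentially"
    then have r: "\<And>n. \<sigma> n \<in> scalar_on p" and lim: "limitin M.mtopology \<sigma> l sequentially" by auto
    from r have \<sigma>: "\<And>n. \<sigma> n \<in> carrier A" by (auto simp: scalar_on_def)
    from r have "\<forall>n. \<exists>c. \<sigma> n \<otimes> p = c \<odot> p \<and> star A (\<sigma> n) \<otimes> p = cnj c \<odot> p"
      by (auto simp: scalar_on_def)
    then obtain c where c: "\<And>n. \<sigma> n \<otimes> p = c n \<odot> p" "\<And>n. star A (\<sigma> n) \<otimes> p = cnj (c n) \<odot> p"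
      by metis
    have l: "l \<in> carrier A" using lim by (simp add: M.limitin_metric)
    have bound: "cnorm A (x \<otimes> p \<ominus> y \<otimes> p) \<le> cstar_dist A x y * cnorm A p"
      if "x \<in> carrier A" "y \<in> carrier A" for x y
      using that p cnorm_mult[of "x \<ominus> y" p] by (simp add: cstar_dist_def diff_mult_distr)
    have cle: "cmod (c m - c n) \<le> cstar_dist A (\<sigma> m) (\<sigma> n)" for m n
    proof -
      have "cmod (c m - c n) * cnorm A p \<le> cstar_dist A (\<sigma> m) (\<sigma> n) * cnorm A p"
        using bound[OF \<sigma> \<sigma>, of m n] p by (simp add: c smult_diff_left cnorm_smult)
      then show ?thesis using pos by simp
    qed
    have dlim: "(\<lambda>n. cstar_dist A (\<sigma> n) l) \<longlonglongrightarrow> 0"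
      using lim by (simp add: M.limitin_metric_dist_null)
    have "Cauchy c"
    proof (rule metric_CauchyI)
      fix e :: real assume "0 < e"
      then have "\<exists>N. \<forall>m n. N \<le> m \<longrightarrow> N \<le> n \<longrightarrow> cstar_dist A (\<sigma> m) (\<sigma> n) < e"
        using M.convergent_imp_MCauchy[of \<sigma> l] lim \<sigma> unfolding M.MCauchy_def by blast
      then obtain N where "\<And>m n. N \<le> m \<Longrightarrow> N \<le> n \<Longrightarrow> cstar_dist A (\<sigma> m) (\<sigma> n) < e" by blast
      then show "\<exists>N. \<forall>m\<ge>N. \<forall>n\<ge>N. dist (c m) (c n) < e"
        using cle by (metis dist_norm le_less_trans)
    qed
    then obtain d where d: "c \<longlonglongrightarrow> d" using Cauchy_convergent convergent_def by blast
    \<comment> \<open>Stated for arbitrary sequences, so that it serves both \<open>\<sigma>\<close>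
      and the adjoints of its members. The difference
      \<open>x \<otimes> p \<ominus> b \<odot> p\<close> is split at
      \<open>y n \<otimes> p = a n \<odot> p\<close>.\<close>
    have key: "x \<otimes> p = b \<odot> p"
      if x: "x \<in> carrier A" and y: "\<And>n. y n \<in> carrier A" and a: "\<And>n. y n \<otimes> p = a n \<odot> p"
        and ylim: "(\<lambda>n. cstar_dist A (y n) x) \<longlonglongrightarrow> 0" and alim: "a \<longlonglongrightarrow> b" for x y a b
    proof -
      have *: "cnorm A (x \<otimes> p \<ominus> b \<odot> p)
          \<le> cstar_dist A (y n) x * cnorm A p + cmod (a n - b) * cnorm A p" for n
      proof -
        have "x \<otimes> p \<ominus> b \<odot> p = (x \<otimes> p \<ominus> y n \<otimes> p) \<oplus> (a n \<odot> p \<ominus> b \<odot> p)"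
          unfolding a using x p by (simp add: diff_add_diff smult_simps)
        then have "cnorm A (x \<otimes> p \<ominus> b \<odot> p)
            \<le> cnorm A (x \<otimes> p \<ominus> y n \<otimes> p) + cnorm A (a n \<odot> p \<ominus> b \<odot> p)"
          using x y p by (simp add: cnorm_triangle smult_simps)
        then show ?thesis
          using bound[OF x y, of n] p M.commute by (simp add: smult_diff_left cnorm_smult)
      qed
      have "(\<lambda>n. cmod (a n - b)) \<longlonglongrightarrow> 0"
        using alim by (simp add: LIM_zero tendsto_norm_zero)
      then have "(\<lambda>n. cstar_dist A (y n) x * cnorm A p + cmod (a n - b) * cnorm A p)
          \<longlonglongrightarrow> 0 * cnorm A p + 0 * cnorm A p"
        by (intro tendsto_intros ylim)
      then have "cnorm A (x \<otimes> p \<ominus> b \<odot> p) \<le> 0"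
        using LIMSEQ_le_const[of _ 0 "cnorm A (x \<otimes> p \<ominus> b \<odot> p)"] * by auto
      then show ?thesis
        using x p cnorm_nonneg[of "x \<otimes> p \<ominus> b \<odot> p"] cnorm_eq_zero[of "x \<otimes> p \<ominus> b \<odot> p"]
        by (simp add: smult_simps diff_eq_zero_iff)
    qed
    \<comment> \<open>The star is isometric, so the adjoints converge to
      \<open>star A l\<close>.\<close>
    have "cstar_dist A (star A (\<sigma> n)) (star A l) = cstar_dist A (\<sigma> n) l" for n
      using \<sigma> l by (simp add: cstar_dist_def star_closed cnorm_star flip: star_diff)
    then have "star A l \<otimes> p = cnj d \<odot> p"
      using d \<sigma> l dlim
      by (intro key[OF _ _ c(2)]) (auto simp: star_closed intro: tendsto_cnj)
    moreover have "l \<otimes> p = d \<odot> p"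
      by (rule key[OF l \<sigma> c(1) dlim d])
    ultimately show "l \<in> scalar_on p" using l by (auto simp: scalar_on_def)
  qed
qed

text \<open>Scalars add and multiply along with the elements. The condition on
  \<open>star A x\<close> in \<open>scalar_on\<close> is what gives closure under the star.\<close>

lemma cstar_subalgebra_scalar_on:
  assumes p: "p \<in> carrier A"
  shows "cstar_subalgebra A (scalar_on p)"
  unfolding cstar_subalgebra_def
proof (intro conjI ballI allI)
  show "closedin M.mtopology (scalar_on p)" by (rule closedin_scalar_on[OF p])
  have "star A \<one> = \<one>"
    by (metis A.one_closed A.l_one A.r_one star_closed star_mult star_star)
  then show "\<one> \<in> scalar_on p"
    using p by (auto simp: scalar_on_def smult_simps intro!: exI[of _ 1])
  fix x assume "x \<in> scalar_on p"
  then obtain c where x: "x \<in> carrier A" "x \<otimes> p = c \<odot> p" "star A x \<otimes> p = cnj c \<odot> p"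
    by (auto simp: scalar_on_def)
  show "star A x \<in> scalar_on p"
    using x p by (auto simp: scalar_on_def star_closed star_star intro!: exI[of _ "cnj c"])
  show "a \<odot> x \<in> scalar_on p" for a
    using x p by (auto simp: scalar_on_def star_smult star_closed smult_mult_left smult_simps
        intro!: exI[of _ "a * c"])
  fix y assume "y \<in> scalar_on p"
  then obtain d where y: "y \<in> carrier A" "y \<otimes> p = d \<odot> p" "star A y \<otimes> p = cnj d \<odot> p"
    by (auto simp: scalar_on_def)
  show "x \<oplus> y \<in> scalar_on p"
    using x y p by (auto simp: scalar_on_def star_add star_closed A.l_distr smult_simps
        intro!: exI[of _ "c + d"])
  \<comment> \<open>The factor \<open>y\<close> acts first, hence the order \<open>d * c\<close>.
    Complex numbers commute, so \<open>star A y \<otimes> star A x\<close> acts by the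
    conjugate.\<close>
  have "(x \<otimes> y) \<otimes> p = (d * c) \<odot> p"
    using x y p by (simp add: A.m_assoc smult_mult_right smult_simps)
  moreover have "star A (x \<otimes> y) \<otimes> p = cnj (d * c) \<odot> p"
    using x y p by (simp add: star_mult star_closed A.m_assoc smult_mult_right mult.commute smult_simps(1)
        flip: smult_simps(4))
  ultimately show "x \<otimes> y \<in> scalar_on p"
    using x y by (auto simp: scalar_on_def)
qed

end

section \<open>Magic unitaries of graphs\<close>

locale graph_magic_unitary_algebra = cstar_algebra_with_ring_facts +
  fixes G :: "'v pair_pre_digraph" and u :: "'v \<Rightarrow> 'v \<Rightarrow> 'a"
  assumes fin: "finite (pverts G)" and gmu: "graph_magic_unitary G A u"
begin

abbreviation "V \<equiv> pverts G"

lemma u_projection: "i \<in> V \<Longrightarrow> j \<in> V \<Longrightarrow> projection A (u i j)"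
  using gmu by (simp add: graph_magic_unitary_def magic_unitary_def)

lemma u_closed [simp]: "i \<in> V \<Longrightarrow> j \<in> V \<Longrightarrow> u i j \<in> carrier A"
  and u_idem: "i \<in> V \<Longrightarrow> j \<in> V \<Longrightarrow> u i j \<otimes> u i j = u i j"
  and u_star: "i \<in> V \<Longrightarrow> j \<in> V \<Longrightarrow> star A (u i j) = u i j"
  using u_projection by (simp_all add: projection_def)

lemma row_orthogonal:
    "i \<in> V \<Longrightarrow> j \<in> V \<Longrightarrow> k \<in> V \<Longrightarrow> j \<noteq> k \<Longrightarrow> u i j \<otimes> u i k = \<zero>"
  and column_orthogonal:
    "i \<in> V \<Longrightarrow> j \<in> V \<Longrightarrow> k \<in> V \<Longrightarrow> j \<noteq> k \<Longrightarrow> u j i \<otimes> u k i = \<zero>"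
  and row_sum: "i \<in> V \<Longrightarrow> (\<Oplus>j\<in>V. u i j) = \<one>"
  and column_sum: "i \<in> V \<Longrightarrow> (\<Oplus>j\<in>V. u j i) = \<one>"
  and intertwiner: "i \<in> V \<Longrightarrow> j \<in> V \<Longrightarrow>
    (\<Oplus>k\<in>V. adjacency G i k \<odot> u k j) = (\<Oplus>k\<in>V. adjacency G k j \<odot> u i k)"
  using gmu by (simp_all add: graph_magic_unitary_def magic_unitary_def)

section \<open>Products of two entries\<close>

text \<open>Serves to insert a row sum, or an entry of \<open>du\<close> or \<open>ud\<close>,
  between two factors that leave a single summand alive.\<close>

lemma sandwich_finsum:
  assumes "x \<in> carrier A" "y \<in> carrier A" "f \<in> V \<rightarrow> carrier A"
    and "k \<in> V" "\<And>j. j \<in> V \<Longrightarrow> j \<noteq> k \<Longrightarrow> x \<otimes> f j \<otimes> y = \<zero>"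
  shows "x \<otimes> (\<Oplus>j\<in>V. f j) \<otimes> y = x \<otimes> f k \<otimes> y"
proof -
  have "x \<otimes> (\<Oplus>j\<in>V. f j) \<otimes> y = (\<Oplus>j\<in>V. x \<otimes> f j \<otimes> y)"
    using assms fin by (simp add: A.finsum_rdistr A.finsum_ldistr Pi_iff)
  also have "\<dots> = x \<otimes> f k \<otimes> y"
    using assms fin by (intro A.finsum_single) auto
  finally show ?thesis .
qed

text \<open>Multiply the entry \<open>(i, l)\<close> of \<open>du = ud\<close> by
  \<open>u i j\<close> on the left and \<open>u k l\<close> on the right. Column orthogonality keeps
  only the coefficient at \<open>(i, k)\<close>, row orthogonality only the one at
  \<open>(j, l)\<close>; one of the two is \<open>0\<close> and the other \<open>1\<close>.\<close>

lemma mult_eq_zero_if_adjacency_differs: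
  assumes v: "i \<in> V" "j \<in> V" "k \<in> V" "l \<in> V"
    and d: "(i, k) \<in> parcs G \<longleftrightarrow> (j, l) \<notin> parcs G"
  shows "u i j \<otimes> u k l = \<zero>"
proof -
  have "u i j \<otimes> (\<Oplus>k'\<in>V. adjacency G i k' \<odot> u k' l) \<otimes> u k l
      = u i j \<otimes> (adjacency G i k \<odot> u k l) \<otimes> u k l"
    using v by (intro sandwich_finsum)
      (auto simp: smult_simps smult_mult_left smult_mult_right A.m_assoc column_orthogonal
        smult_zero_right)
  moreover have "u i j \<otimes> (\<Oplus>m\<in>V. adjacency G m l \<odot> u i m) \<otimes> u k l
      = u i j \<otimes> (adjacency G j l \<odot> u i j) \<otimes> u k l"
    using v by (intro sandwich_finsum)
      (auto simp: smult_simps smult_mult_left smult_mult_right row_orthogonal smult_zero_right)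
  ultimately have "adjacency G i k \<odot> (u i j \<otimes> u k l) = adjacency G j l \<odot> (u i j \<otimes> u k l)"
    using v intertwiner[of i l]
    by (simp add: smult_simps smult_mult_left smult_mult_right A.m_assoc u_idem)
  then show ?thesis
    using d v by (auto simp: adjacency_def smult_simps split: if_splits)
qed

text \<open>In the inserted sum of the \<open>u m r\<close> a term survives only if \<open>r\<close>
  is a common \<open>R\<close>-neighbour of \<open>j\<close> and \<open>l\<close>. Abstracting to a
  relation \<open>R\<close> covers the graph and its complement at once.\<close>

lemma mult_eq_triangle:
  assumes v: "i \<in> V" "j \<in> V" "k \<in> V" "l \<in> V" "m \<in> V" "n \<in> V"
    and R: "\<And>i j k l. \<lbrakk>i \<in> V; j \<in> V; k \<in> V; l \<in> V; R i k \<noteq> R j l\<rbrakk> \<Longrightarrow> u i j \<otimes> u k l = \<zero>"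
    and m: "R i m" "R m k"
    and n: "\<And>r. r \<in> V \<Longrightarrow> R j r \<Longrightarrow> R r l \<Longrightarrow> r = n"
  shows "u i j \<otimes> u k l = u i j \<otimes> u m n \<otimes> u k l"
proof -
  have "u i j \<otimes> (\<Oplus>r\<in>V. u m r) \<otimes> u k l = u i j \<otimes> u m n \<otimes> u k l"
  proof (rule sandwich_finsum)
    fix r assume r: "r \<in> V" "r \<noteq> n"
    then consider "\<not> R j r" | "\<not> R r l" using n by blast
    then show "u i j \<otimes> u m r \<otimes> u k l = \<zero>"
    proof cases
      case 1
      then have "u i j \<otimes> u m r = \<zero>" using R[of i j m r] m v r by simp
      then show ?thesis using v by simp
    next
      case 2
      then have "u m r \<otimes> u k l = \<zero>" using R[of m r k l] m v r by simp
      then show ?thesis using v r by (simp add: A.m_assoc)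
    qed
  qed (use v in auto)
  then show ?thesis using v row_sum[of m] by simp
qed

text \<open>The common neighbours complete \<open>i, k\<close> and \<open>j, l\<close> to triangles
  \<open>i, m, k\<close> and \<open>j, n, l\<close>. In a triangle each vertex is the unique common
  neighbour of the other two, so \<open>mult_eq_triangle\<close> holds for the three entries in any
  order.\<close>

lemma entries_commute_if_unique_common_neighbour:
  assumes v: "i \<in> V" "j \<in> V" "k \<in> V" "l \<in> V"
    and R: "\<And>i j k l. \<lbrakk>i \<in> V; j \<in> V; k \<in> V; l \<in> V; R i k \<noteq> R j l\<rbrakk> \<Longrightarrow> u i j \<otimes> u k l = \<zero>"
    and sym: "\<And>i k. R i k \<Longrightarrow> R k i"
    and uni: "\<And>i k. \<lbrakk>i \<in> V; k \<in> V; R i k\<rbrakk> \<Longrightarrow> \<exists>!m. m \<in> V \<and> R i m \<and> R m k"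
    and ik: "R i k" and jl: "R j l"
  shows "u i j \<otimes> u k l = u k l \<otimes> u i j"
proof -
  obtain m where m: "m \<in> V" "R i m" "R m k" using uni[of i k] v ik by blast
  obtain n where n: "n \<in> V" "R j n" "R n l" using uni[of j l] v jl by blast
  have sy: "R k i" "R l j" "R m i" "R k m" "R n j" "R l n" using sym ik jl m n by blast+
  \<comment> \<open>Uniqueness for the pair \<open>b\<close>, \<open>d\<close> leaves
    \<open>q\<close> as the only possible index.\<close>
  have tri: "u a b \<otimes> u c d = u a b \<otimes> u p q \<otimes> u c d"
    if "a \<in> V" "b \<in> V" "c \<in> V" "d \<in> V" "p \<in> V" "q \<in> V" "R a p" "R p c" "R b q" "R q d" "R b d"
    for a b c d p q
    by (rule mult_eq_triangle[where R = R, OF that(1-6) _ that(7,8)])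
      (erule (4) R, use uni[of b d] that in blast)
  show ?thesis
    by (rule projections_commute_if_triangle[where z = "u m n"])
      (rule u_projection tri v m n sy ik jl)+
qed

text \<open>Entries of one row or column are equal or orthogonal. If both index pairs are edges, or
  both are edges of the complement, the triangle argument applies; in the mixed case both products
  vanish.\<close>

lemma entries_commute:
  assumes v: "i \<in> V" "j \<in> V" "k \<in> V" "l \<in> V"
    and sym: "\<And>i k. (i, k) \<in> parcs G \<Longrightarrow> (k, i) \<in> parcs G"
    and adj: "\<And>i k. \<lbrakk>i \<in> V; k \<in> V; (i, k) \<in> parcs G\<rbrakk> \<Longrightarrow>
      \<exists>!m. m \<in> V \<and> (i, m) \<in> parcs G \<and> (m, k) \<in> parcs G"
    and nonadj: "\<And>i k. \<lbrakk>i \<in> V; k \<in> V; i \<noteq> k; (i, k) \<notin> parcs G\<rbrakk> \<Longrightarrow>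
      \<exists>!m. m \<in> V \<and> (i \<noteq> m \<and> (i, m) \<notin> parcs G) \<and> (m \<noteq> k \<and> (m, k) \<notin> parcs G)"
  shows "u i j \<otimes> u k l = u k l \<otimes> u i j"
proof -
  let ?N = "\<lambda>i k. i \<noteq> k \<and> (i, k) \<notin> parcs G"
  \<comment> \<open>When the adjacencies agree but \<open>?N\<close> differs, exactly one of the
    pairs consists of equal vertices, and orthogonality within a row or column applies.\<close>
  have N: "u i j \<otimes> u k l = \<zero>" if w: "i \<in> V" "j \<in> V" "k \<in> V" "l \<in> V" and d: "?N i k \<noteq> ?N j l"
    for i j k l
  proof (cases "(i, k) \<in> parcs G \<longleftrightarrow> (j, l) \<in> parcs G")
    case True
    then have "i = k \<and> j \<noteq> l \<or> i \<noteq> k \<and> j = l" using d by auto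
    then show ?thesis using w row_orthogonal column_orthogonal by auto
  qed (use w mult_eq_zero_if_adjacency_differs in blast)
  consider "i = k" | "j = l" | "(i, k) \<in> parcs G" "(j, l) \<in> parcs G" | "?N i k" "?N j l"
    | "i \<noteq> k" "j \<noteq> l" "(i, k) \<in> parcs G \<longleftrightarrow> (j, l) \<notin> parcs G"
    by blast
  then show ?thesis
  proof cases
    case 1
    then show ?thesis using v row_orthogonal[of i] by (cases "j = l") auto
  next
    case 2
    then show ?thesis using v column_orthogonal[of j] by (cases "i = k") auto
  next
    case 3
    show ?thesis
      by (rule entries_commute_if_unique_common_neighbour[where R = "\<lambda>i k. (i, k) \<in> parcs G",
            OF v _ sym adj 3])
        (rule mult_eq_zero_if_adjacency_differs; blast)
  next
    case 4
    have symN: "?N k i" if "?N i k" for i k using that sym by blast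
    show ?thesis
      by (rule entries_commute_if_unique_common_neighbour[where R = ?N, OF v N symN nonadj 4])
        blast+
  next
    case 5
    then have "(k, i) \<in> parcs G \<longleftrightarrow> (l, j) \<notin> parcs G" using sym by blast
    with 5 show ?thesis using v mult_eq_zero_if_adjacency_differs by simp
  qed
qed

section \<open>Products of entries along lists of vertices\<close>

text \<open>
  \<open>branch js \<rho>\<close> is the projection onto the part of the quantum space on which the vertices \<open>js\<close> are
  moved according to \<open>\<rho>\<close>.
\<close>
primrec branch :: "'v list \<Rightarrow> ('v \<Rightarrow> 'v) \<Rightarrow> 'a" where
  "branch [] \<rho> = \<one>"
| "branch (j # js) \<rho> = u (\<rho> j) j \<otimes> branch js \<rho>"

lemma branch_closed:
  "set js \<subseteq> V \<Longrightarrow> \<rho> \<in> set js \<rightarrow> V \<Longrightarrow> branch js \<rho> \<in> carrier A"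
  by (induction js) auto

lemma branch_cong: "(\<And>j. j \<in> set js \<Longrightarrow> \<rho> j = \<tau> j) \<Longrightarrow> branch js \<rho> = branch js \<tau>"
  by (induction js) auto

text \<open>Expand \<open>z\<close> by the column sum at the head \<open>j\<close>. Each
  \<open>z \<otimes> u i j\<close> is annihilated by all branches along the tail, so it vanishes by
  induction.\<close>

lemma eq_zero_if_branches_zero:
  assumes "z \<in> carrier A" "set js \<subseteq> V" "distinct js"
    and "\<And>\<rho>. \<rho> \<in> set js \<rightarrow> V \<Longrightarrow> z \<otimes> branch js \<rho> = \<zero>"
  shows "z = \<zero>"
  using assms
proof (induction js arbitrary: z)
  case Nil
  then show ?case by simp
next
  case (Cons j js)
  have j: "j \<in> V" using Cons.prems by simp
  have zero: "z \<otimes> u i j = \<zero>" if i: "i \<in> V" for i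
  proof (rule Cons.IH)
    fix \<rho> assume \<rho>: "\<rho> \<in> set js \<rightarrow> V"
    \<comment> \<open>Distinctness of the list keeps \<open>j\<close> out of \<open>js\<close>, so
      the update is invisible there.\<close>
    have eq: "branch js (\<rho>(j := i)) = branch js \<rho>"
      using Cons.prems by (intro branch_cong) auto
    have "z \<otimes> branch (j # js) (\<rho>(j := i)) = \<zero>"
      using \<rho> i by (intro Cons.prems) auto
    then have "z \<otimes> (u i j \<otimes> branch js \<rho>) = \<zero>" by (simp add: eq)
    then show "z \<otimes> u i j \<otimes> branch js \<rho> = \<zero>"
      using Cons.prems i j \<rho> by (simp add: A.m_assoc branch_closed)
  qed (use Cons.prems i j in auto)
  have "z \<otimes> (\<Oplus>i\<in>V. u i j) = (\<Oplus>i\<in>V. z \<otimes> u i j)"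
    using fin j Cons.prems by (intro A.finsum_rdistr) auto
  also have "\<dots> = (\<Oplus>i\<in>V. \<zero>)" using zero by (intro A.finsum_cong') auto
  finally show ?case using Cons.prems column_sum[OF j] by (simp add: A.finsum_zero)
qed

end

locale commuting_graph_magic_unitary = graph_magic_unitary_algebra +
  assumes comm: "\<lbrakk>i \<in> V; j \<in> V; k \<in> V; l \<in> V\<rbrakk> \<Longrightarrow> u i j \<otimes> u k l = u k l \<otimes> u i j"
begin

text \<open>Commutation moves \<open>u i j\<close> to a factor \<open>u (\<rho> j) j\<close> of the
  same column, where idempotency or column orthogonality decides.\<close>

lemma entry_mult_branch:
  assumes "set js \<subseteq> V" "\<rho> \<in> set js \<rightarrow> V" "j \<in> set js" "i \<in> V"
  shows "u i j \<otimes> branch js \<rho> = (if \<rho> j = i then branch js \<rho> else \<zero>)"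
  using assms
proof (induction js)
  case (Cons k js)
  then have c: "branch js \<rho> \<in> carrier A" and v: "j \<in> V" "k \<in> V" "\<rho> k \<in> V" "\<rho> j \<in> V"
    by (auto intro: branch_closed)
  show ?case
  proof (cases "j = k")
    case True
    then show ?thesis
      using c v Cons.prems column_orthogonal[of k i "\<rho> k"]
      by (auto simp: u_idem simp flip: A.m_assoc)
  next
    case False
    have "u i j \<otimes> branch (k # js) \<rho> = u (\<rho> k) k \<otimes> (u i j \<otimes> branch js \<rho>)"
      using c v Cons.prems comm[of i j "\<rho> k" k] by (simp flip: A.m_assoc)
    also have "u i j \<otimes> branch js \<rho> = (if \<rho> j = i then branch js \<rho> else \<zero>)"
      using False Cons.prems by (intro Cons.IH) auto
    finally show ?thesis using v by auto
  qed
qed simp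

text \<open>The branch absorbs each of its factors, so one vanishing product of two factors kills
  it. Such a product comes from row orthogonality if \<open>\<rho>\<close> is not injective, and
  otherwise from a pair of vertices whose adjacency the permutation \<open>\<rho>\<close>
  changes.\<close>

lemma branch_eq_zero:
  assumes js: "set js = V" and \<rho>: "\<rho> \<in> V \<rightarrow> V" "\<And>j. j \<notin> V \<Longrightarrow> \<rho> j = j" "\<rho> \<notin> graph_auts G"
  shows "branch js \<rho> = \<zero>"
proof -
  have self: "u (\<rho> j) j \<otimes> branch js \<rho> = branch js \<rho>" if "j \<in> V" for j
    using that js \<rho> entry_mult_branch[of js \<rho> j "\<rho> j"] by auto
  have c: "branch js \<rho> \<in> carrier A" using js \<rho> by (intro branch_closed) auto
  have zero: "branch js \<rho> = \<zero>"
    if "j \<in> V" "k \<in> V" "u (\<rho> j) j \<otimes> u (\<rho> k) k = \<zero>" for j k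
  proof -
    have "branch js \<rho> = u (\<rho> j) j \<otimes> (u (\<rho> k) k \<otimes> branch js \<rho>)" using self that by simp
    also have "\<dots> = u (\<rho> j) j \<otimes> u (\<rho> k) k \<otimes> branch js \<rho>"
      using that \<rho> c by (intro A.m_assoc[symmetric] u_closed) auto
    finally show ?thesis using that c by simp
  qed
  show ?thesis
  proof (cases "inj_on \<rho> V")
    case False
    then obtain j k where "j \<in> V" "k \<in> V" "j \<noteq> k" "\<rho> j = \<rho> k" by (auto simp: inj_on_def)
    then show ?thesis using zero[of j k] row_orthogonal[of "\<rho> k" j k] \<rho> by auto
  next
    case True
    have "\<rho> ` V = V" by (rule endo_inj_surj[OF fin _ True]) (use \<rho> in auto)
    then have "bij_betw \<rho> V V" using True by (simp add: bij_betw_def)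
    then have "\<rho> permutes V" using \<rho> by (intro bij_imp_permutes) auto
    then obtain j k where "j \<in> V" "k \<in> V" "(\<rho> j, \<rho> k) \<in> parcs G \<longleftrightarrow> (j, k) \<notin> parcs G"
      using \<rho> by (auto simp: graph_auts_def)
    then show ?thesis
      using zero[of j k] mult_eq_zero_if_adjacency_differs[of "\<rho> j" j "\<rho> k" k] \<rho> by auto
  qed
qed

lemma eq_zero_if_graph_auts_branches_zero:
  assumes z: "z \<in> carrier A" and js: "set js = V" "distinct js"
    and zero: "\<And>\<rho>. \<rho> \<in> graph_auts G \<Longrightarrow> z \<otimes> branch js \<rho> = \<zero>"
  shows "z = \<zero>"
proof (rule eq_zero_if_branches_zero)
  fix \<rho> assume \<rho>: "\<rho> \<in> set js \<rightarrow> V"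
  \<comment> \<open>Elements of \<open>graph_auts G\<close> are the identity off \<open>V\<close>;
    the branch only sees values on \<open>V\<close>.\<close>
  define \<tau> where "\<tau> j = (if j \<in> V then \<rho> j else j)" for j
  have "branch js \<rho> = branch js \<tau>" using js by (intro branch_cong) (simp add: \<tau>_def)
  moreover have "branch js \<tau> = \<zero>" if "\<tau> \<notin> graph_auts G"
    using that \<rho> js by (intro branch_eq_zero) (auto simp: \<tau>_def)
  ultimately show "z \<otimes> branch js \<rho> = \<zero>" using zero[of \<tau>] z by (metis A.r_null)
qed (use assms in auto)

end

section \<open>Algebras of functions\<close>

lemma function_algebra_simps:
  "carrier (function_algebra S) = S \<rightarrow>\<^sub>E UNIV"
  "f \<otimes>\<^bsub>function_algebra S\<^esub> g = (\<lambda>s\<in>S. f s * g s)"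
  "f \<oplus>\<^bsub>function_algebra S\<^esub> g = (\<lambda>s\<in>S. f s + g s)"
  "c \<odot>\<^bsub>function_algebra S\<^esub> f = (\<lambda>s\<in>S. c * f s)"
  "star (function_algebra S) f = (\<lambda>s\<in>S. cnj (f s))"
  "\<zero>\<^bsub>function_algebra S\<^esub> = (\<lambda>s\<in>S. 0)"
  "\<one>\<^bsub>function_algebra S\<^esub> = (\<lambda>s\<in>S. 1)"
  by (simp_all add: function_algebra_def)

lemma pullback_cstar_hom:
  assumes "e \<in> S \<rightarrow> T"
  shows "(\<lambda>f. \<lambda>s\<in>S. f (e s)) \<in> cstar_hom (function_algebra T) (function_algebra S)"
  using assms by (auto simp: cstar_hom_def ring_hom_def function_algebra_simps fun_eq_iff)

lemma cstar_hom_comp: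
  "\<phi> \<in> cstar_hom A B \<Longrightarrow> \<psi> \<in> cstar_hom B C \<Longrightarrow> (\<lambda>x. \<psi> (\<phi> x)) \<in> cstar_hom A C"
  by (auto simp: cstar_hom_def ring_hom_def Pi_iff)

lemma finsum_function_algebra:
  assumes S: "finite S" "S \<noteq> {}" and "finite V" "f \<in> V \<rightarrow> S \<rightarrow>\<^sub>E UNIV"
  shows "(\<Oplus>\<^bsub>function_algebra S\<^esub>k\<in>V. f k) = (\<lambda>s\<in>S. \<Sum>k\<in>V. f k s)"
proof -
  interpret ring "function_algebra S"
    by (rule unital_cstar_algebra.axioms(1)[OF unital_cstar_algebra_function_algebra[OF S]])
  show ?thesis
    using assms(3,4)
  proof (induction V)
    case empty
    then show ?case by (simp add: function_algebra_simps)
  next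
    case (insert k V)
    have c: "f k \<in> carrier (function_algebra S)" "f \<in> V \<rightarrow> carrier (function_algebra S)"
      using insert by (auto simp: function_algebra_simps)
    have IH: "finsum (function_algebra S) f V = (\<lambda>s\<in>S. \<Sum>k\<in>V. f k s)"
      using insert by auto
    show ?case
      using insert.hyps c by (simp add: IH) (auto simp: function_algebra_simps)
  qed
qed

text \<open>At each \<open>s\<close> the matrix is the permutation matrix of \<open>e s\<close>, so
  the relations can be checked pointwise. Indexing through \<open>e\<close> admits a set of numbers
  as \<open>S\<close>, as the test algebras of the universal property require.\<close>

lemma graph_magic_unitary_function_algebra:
  assumes S: "finite S" "S \<noteq> {}" and V: "finite (pverts G)" and e: "e \<in> S \<rightarrow> graph_auts G"
  shows "graph_magic_unitary G (function_algebra S) (\<lambda>i j. \<lambda>s\<in>S. if e s j = i then 1 else 0)"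
proof -
  have perm: "e s permutes pverts G" if "s \<in> S" for s
    using e that by (auto simp: graph_auts_def)
  have inj: "e s i = e s j \<longleftrightarrow> i = j" if "s \<in> S" for s i j
    using permutes_inj[OF perm[OF that]] by (auto simp: inj_on_def)
  have preimage: "\<exists>j\<in>pverts G. \<forall>k. e s k = i \<longleftrightarrow> k = j" if s: "s \<in> S" and i: "i \<in> pverts G" for s i
  proof -
    obtain j where "j \<in> pverts G" "i = e s j"
      using permutes_image[OF perm[OF s]] i by blast
    then show ?thesis using inj[OF s] by auto
  qed
  have image: "e s j \<in> pverts G" if "s \<in> S" "j \<in> pverts G" for s j
    using permutes_in_image[OF perm[OF that(1)]] that(2) by simp
  \<comment> \<open>With \<open>m\<close> the preimage of \<open>i\<close>, the sums reduce to the
    adjacencies of \<open>(i, e s j)\<close> and \<open>(m, j)\<close>, which the automorphism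
    \<open>e s\<close> identifies.\<close>
  have intertwined: "(\<Sum>k\<in>pverts G. adjacency G i k * (if e s j = k then 1 else 0)) =
      (\<Sum>k\<in>pverts G. adjacency G k j * (if e s k = i then 1 else 0))"
    if s: "s \<in> S" and v: "i \<in> pverts G" "j \<in> pverts G" for s i j
  proof -
    obtain m where m: "m \<in> pverts G" "\<And>k. e s k = i \<longleftrightarrow> k = m" using preimage[OF s v(1)] by blast
    then have "e s m = i" by blast
    then have "adjacency G i (e s j) = adjacency G m j"
      using e s v m by (force simp: adjacency_def graph_auts_def)
    then show ?thesis
      using V m v s image[of s j] by (simp add: if_distrib sum.delta cong: if_cong)
  qed
  have sums: "(\<Sum>j\<in>pverts G. if e s j = i then 1 else (0 :: complex)) = 1"
    "(\<Sum>j\<in>pverts G. if e s i = j then 1 else (0 :: complex)) = 1"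
    if s: "s \<in> S" and i: "i \<in> pverts G" for s i
    using preimage[OF s i] image[OF s i] V by (auto simp: sum.delta)
  let ?F = "function_algebra S" and ?v = "\<lambda>i j. \<lambda>s\<in>S. if e s j = i then 1 else (0 :: complex)"
  note simps = function_algebra_simps
  show ?thesis
    unfolding graph_magic_unitary_def magic_unitary_def projection_def
  proof (intro conjI ballI impI)
    fix i j k
    show "?v i j \<in> carrier ?F" by (simp add: simps)
    show "?v i j \<otimes>\<^bsub>?F\<^esub> ?v i j = ?v i j" by (auto simp: simps intro!: restrict_ext)
    show "star ?F (?v i j) = ?v i j" by (auto simp: simps intro!: restrict_ext)
    show "?v i j \<otimes>\<^bsub>?F\<^esub> ?v i k = \<zero>\<^bsub>?F\<^esub>" if "j \<noteq> k"
      using inj that by (auto simp: simps intro!: restrict_ext)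
    show "?v j i \<otimes>\<^bsub>?F\<^esub> ?v k i = \<zero>\<^bsub>?F\<^esub>" if "j \<noteq> k"
      using that by (auto simp: simps intro!: restrict_ext)
    assume i: "i \<in> pverts G"
    show "(\<Oplus>\<^bsub>?F\<^esub>j\<in>pverts G. ?v i j) = \<one>\<^bsub>?F\<^esub>" "(\<Oplus>\<^bsub>?F\<^esub>j\<in>pverts G. ?v j i) = \<one>\<^bsub>?F\<^esub>"
      using i sums by (auto simp: finsum_function_algebra[OF S V] simps intro!: restrict_ext)
    assume j: "j \<in> pverts G"
    show "(\<Oplus>\<^bsub>?F\<^esub>k\<in>pverts G. adjacency G i k \<odot>\<^bsub>?F\<^esub> ?v k j) =
        (\<Oplus>\<^bsub>?F\<^esub>k\<in>pverts G. adjacency G k j \<odot>\<^bsub>?F\<^esub> ?v i k)"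
      using intertwined i j
      by (auto simp: finsum_function_algebra[OF S V] simps intro!: restrict_ext)
  qed
qed

section \<open>The canonical surjection\<close>

text \<open>The test algebras have carriers inside \<open>nat \<Rightarrow> complex\<close>, so the
  automorphisms are first enumerated by numbers. The resulting homomorphism is then carried back
  along the inverse enumeration \<open>g\<close>.\<close>

lemma ex_canonical_surjection:
  assumes q: "is_quantum_aut_algebra G A u" and V: "finite (pverts G)"
  shows "\<exists>\<phi>. is_canonical_surjection G A u \<phi>"
proof -
  let ?S = "graph_auts G"
  let ?T = "{0..<card ?S}"
  have fin: "finite ?S" by (rule finite_graph_auts[OF V])
  have "card ?S \<noteq> 0" using fin id_in_graph_auts[of G] by auto
  then have T: "finite ?T" "?T \<noteq> {}" by auto
  obtain e where e: "bij_betw e ?T ?S" using ex_bij_betw_nat_finite[OF fin] by blast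
  then obtain g where g: "bij_betw g ?S ?T" and eg: "\<And>\<rho>. \<rho> \<in> ?S \<Longrightarrow> e (g \<rho>) = \<rho>"
    by (metis bij_betw_inv_into bij_betw_inv_into_right)
  from g have gT: "g \<in> ?S \<rightarrow> ?T" by (auto simp: bij_betw_def)
  have "e \<in> ?T \<rightarrow> ?S" using e by (auto simp: bij_betw_def)
  then have "graph_magic_unitary G (function_algebra ?T) (\<lambda>i j. \<lambda>t\<in>?T. if e t j = i then 1 else 0)"
    by (rule graph_magic_unitary_function_algebra[OF T V])
  with q unital_cstar_algebra_function_algebra[OF T] obtain \<psi>
    where \<psi>: "\<psi> \<in> cstar_hom A (function_algebra ?T)"
      and \<psi>u: "\<forall>i\<in>pverts G. \<forall>j\<in>pverts G. \<psi> (u i j) = (\<lambda>t\<in>?T. if e t j = i then 1 else 0)"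
    unfolding is_quantum_aut_algebra_def by blast
  have "is_canonical_surjection G A u (\<lambda>x. \<lambda>\<rho>\<in>?S. \<psi> x (g \<rho>))"
    unfolding is_canonical_surjection_def
    using cstar_hom_comp[OF \<psi> pullback_cstar_hom[OF gT]] \<psi>u gT eg
    by (auto simp: fun_eq_iff)
  then show ?thesis by blast
qed

text \<open>The map \<open>\<phi>\<close> sends the branch of an automorphism to the indicator
  function of that automorphism. The branches thus give surjectivity, the scalars by which elements
  act on them give injectivity, and commutativity is pulled back.\<close>

lemma (in commuting_graph_magic_unitary) no_quantum_symmetry_and_cring:
  assumes q: "is_quantum_aut_algebra G A u"
  shows "no_quantum_symmetry G A u \<and> cring A"
proof -
  let ?S = "graph_auts G" and ?F = "function_algebra (graph_auts G)"
  obtain \<phi> where can: "is_canonical_surjection G A u \<phi>"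
    using ex_canonical_surjection[OF q fin] by blast
  then have hom: "\<phi> \<in> cstar_hom A ?F"
    and \<phi>u: "\<And>i j. i \<in> V \<Longrightarrow> j \<in> V \<Longrightarrow> \<phi> (u i j) = (\<lambda>\<rho>\<in>?S. if \<rho> j = i then 1 else 0)"
    by (auto simp: is_canonical_surjection_def)
  then have rh: "\<phi> \<in> ring_hom A ?F"
    and \<phi>_smult: "\<And>c x. x \<in> carrier A \<Longrightarrow> \<phi> (c \<odot> x) = c \<odot>\<^bsub>?F\<^esub> \<phi> x"
    by (auto simp: cstar_hom_def)
  note \<phi>_simps = ring_hom_mult[OF rh] ring_hom_add[OF rh] ring_hom_one[OF rh] \<phi>_smult
  have \<phi>_closed: "\<phi> x \<in> ?S \<rightarrow>\<^sub>E UNIV" if "x \<in> carrier A" for x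
    using ring_hom_closed[OF rh that] by (simp add: function_algebra_simps)
  obtain js where js: "set js = V" "distinct js" using finite_distinct_list[OF fin] by blast
  have autV: "\<rho> \<in> V \<rightarrow> V" if "\<rho> \<in> ?S" for \<rho>
    using that permutes_in_image by (fastforce simp: graph_auts_def)
  have bc: "branch js \<rho> \<in> carrier A" if "\<rho> \<in> ?S" for \<rho>
    using branch_closed[of js \<rho>] js autV[OF that] by simp
  \<comment> \<open>Partial lists are needed for the induction; only the full list \<open>js\<close>
    singles out one automorphism.\<close>
  have \<phi>_branch_list: "\<phi> (branch ks \<rho>) \<tau> = (if \<forall>j\<in>set ks. \<tau> j = \<rho> j then 1 else 0)"
    if "set ks \<subseteq> V" "\<rho> \<in> ?S" "\<tau> \<in> ?S" for ks \<rho> \<tau>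
    using that(1)
  proof (induction ks)
    case Nil
    then show ?case using that by (simp add: \<phi>_simps function_algebra_simps)
  next
    case (Cons k ks)
    then have "branch ks \<rho> \<in> carrier A" "\<rho> k \<in> V" "k \<in> V"
      using autV[OF that(2)] by (auto intro!: branch_closed)
    then show ?case
      using Cons that by (auto simp: \<phi>_simps \<phi>u function_algebra_simps)
  qed
  have \<phi>_branch: "\<phi> (branch js \<rho>) \<tau> = (if \<tau> = \<rho> then 1 else 0)" if "\<rho> \<in> ?S" "\<tau> \<in> ?S" for \<rho> \<tau>
  proof -
    have "\<tau> = \<rho>" if "\<forall>j\<in>V. \<tau> j = \<rho> j"
    proof
      show "\<tau> x = \<rho> x" for x
        using that \<open>\<rho> \<in> ?S\<close> \<open>\<tau> \<in> ?S\<close> by (cases "x \<in> V") (auto simp: graph_auts_def permutes_def)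
    qed
    then show ?thesis using \<phi>_branch_list[of js \<rho> \<tau>] that js by auto
  qed
  have scalar: "x \<otimes> branch js \<rho> = \<phi> x \<rho> \<odot> branch js \<rho>" if x: "x \<in> carrier A" and \<rho>: "\<rho> \<in> ?S" for x \<rho>
  proof -
    let ?p = "branch js \<rho>"
    \<comment> \<open>Each entry acts on \<open>?p\<close> by \<open>0\<close> or \<open>1\<close>,
      so the C*-subalgebra \<open>scalar_on ?p\<close> contains all generators.\<close>
    have "u i j \<in> scalar_on ?p" if v: "i \<in> V" "j \<in> V" for i j
    proof -
      have "u i j \<otimes> ?p = (if \<rho> j = i then 1 else 0) \<odot> ?p"
        using entry_mult_branch[of js \<rho> j i] v js autV[OF \<rho>] bc[OF \<rho>] by (simp add: smult_simps)
      then show ?thesis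
        using v unfolding scalar_on_def
        by (auto simp: u_star intro!: exI[of _ "if \<rho> j = i then 1 else 0"])
    qed
    then have "scalar_on ?p = carrier A"
      using q cstar_subalgebra_scalar_on[OF bc[OF \<rho>]]
      unfolding is_quantum_aut_algebra_def cstar_generated_def by blast
    then obtain c where c: "x \<otimes> ?p = c \<odot> ?p" using x by (auto simp: scalar_on_def)
    \<comment> \<open>Evaluation at \<open>\<rho>\<close>, where the image of \<open>?p\<close> is
      \<open>1\<close>, identifies the scalar.\<close>
    then have "\<phi> (x \<otimes> ?p) \<rho> = \<phi> (c \<odot> ?p) \<rho>" by simp
    then have "\<phi> x \<rho> = c"
      using x \<rho> bc[OF \<rho>] by (simp add: \<phi>_simps function_algebra_simps \<phi>_branch)
    with c show ?thesis by simp
  qed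
  have inj: "x = y" if x: "x \<in> carrier A" and y: "y \<in> carrier A" and eq: "\<phi> x = \<phi> y" for x y
  proof -
    have zero: "(x \<ominus> y) \<otimes> branch js \<rho> = \<zero>" if "\<rho> \<in> ?S" for \<rho>
      using x y bc[OF that] scalar[OF x that] scalar[OF y that] eq
      by (simp add: diff_mult_distr diff_eq_zero_iff smult_simps)
    have "x \<ominus> y = \<zero>"
      by (rule eq_zero_if_graph_auts_branches_zero[OF A.minus_closed[OF x y] js zero])
    then show ?thesis using x y by (simp add: diff_eq_zero_iff)
  qed
  have surj: "f \<in> \<phi> ` carrier A" if f: "f \<in> ?S \<rightarrow>\<^sub>E UNIV" for f
  proof -
    \<comment> \<open>Induction on the support: a new point \<open>\<rho>\<close> contributes the
      multiple \<open>f \<rho>\<close> of its branch.\<close>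
    have "\<exists>x\<in>carrier A. \<forall>\<tau>\<in>?S. \<phi> x \<tau> = (if \<tau> \<in> T then f \<tau> else 0)" if "finite T" "T \<subseteq> ?S" for T
      using that
    proof (induction T)
      case empty
      \<comment> \<open>Writing zero as \<open>0 \<odot> \<one>\<close> makes its image computable
        from the rules in \<open>\<phi>_simps\<close>.\<close>
      have "\<phi> (0 \<odot> \<one>) \<tau> = 0" if "\<tau> \<in> ?S" for \<tau>
        using that by (simp only: \<phi>_simps A.one_closed) (simp add: function_algebra_simps)
      then show ?case by (intro bexI[of _ "0 \<odot> \<one>"]) (auto simp: smult_simps)
    next
      case (insert \<rho> T)
      then obtain x where x: "x \<in> carrier A" "\<forall>\<tau>\<in>?S. \<phi> x \<tau> = (if \<tau> \<in> T then f \<tau> else 0)" by auto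
      then show ?case
        using insert bc[of \<rho>]
        by (intro bexI[of _ "x \<oplus> f \<rho> \<odot> branch js \<rho>"])
          (auto simp: \<phi>_simps function_algebra_simps \<phi>_branch smult_simps(1))
    qed
    from this[of ?S] obtain x where x: "x \<in> carrier A" "\<forall>\<tau>\<in>?S. \<phi> x \<tau> = f \<tau>"
      using finite_graph_auts[OF fin] by auto
    then have "f = \<phi> x" using \<phi>_closed[OF x(1)] f by (intro PiE_ext[of f ?S]) auto
    then show ?thesis using x by blast
  qed
  have "\<phi> ` carrier A = ?S \<rightarrow>\<^sub>E UNIV" using surj \<phi>_closed by blast
  moreover have "inj_on \<phi> (carrier A)" by (intro inj_onI inj)
  ultimately have "bij_betw \<phi> (carrier A) (carrier ?F)"
    by (simp add: bij_betw_def function_algebra_simps)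
  then have nqs: "no_quantum_symmetry G A u"
    using can hom by (auto simp: no_quantum_symmetry_def cstar_iso_def)
  have "x \<otimes> y = y \<otimes> x" if "x \<in> carrier A" "y \<in> carrier A" for x y
    using that by (intro inj) (auto simp: \<phi>_simps function_algebra_simps mult.commute)
  then have "cring A"
    by (intro cring.intro A.ring_axioms A.monoid_comm_monoidI)
  with nqs show ?thesis by blast
qed

section \<open>The torus\<close>

lemma no_quantum_symmetry_if_unique_common_neighbours:
  fixes A :: "('a, 'm) cstar_algebra_scheme"
  assumes G: "pair_graph G" and q: "is_quantum_aut_algebra G A u"
    and adj: "\<And>i k. \<lbrakk>i \<in> pverts G; k \<in> pverts G; (i, k) \<in> parcs G\<rbrakk> \<Longrightarrow>
      \<exists>!m. m \<in> pverts G \<and> (i, m) \<in> parcs G \<and> (m, k) \<in> parcs G"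
    and nonadj: "\<And>i k. \<lbrakk>i \<in> pverts G; k \<in> pverts G; i \<noteq> k; (i, k) \<notin> parcs G\<rbrakk> \<Longrightarrow>
      \<exists>!m. m \<in> pverts G \<and> (i \<noteq> m \<and> (i, m) \<notin> parcs G) \<and> (m \<noteq> k \<and> (m, k) \<notin> parcs G)"
  shows "no_quantum_symmetry G A u \<and> cring A"
proof -
  interpret G: pair_graph G by fact
  have "unital_cstar_algebra A" using q by (simp add: is_quantum_aut_algebra_def)
  then interpret cstar_algebra_with_ring_facts A
    by (intro cstar_algebra_with_ring_facts.intro unital_cstar_algebra.axioms(1))
  interpret graph_magic_unitary_algebra A G u
    using q by unfold_locales (simp_all add: is_quantum_aut_algebra_def)
  have sym: "(k, i) \<in> parcs G" if "(i, k) \<in> parcs G" for i k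
    using G.pair_sym_arcs that by (auto simp: symmetric_def dest: symD)
  interpret commuting_graph_magic_unitary A G u
    by unfold_locales (rule entries_commute[OF _ _ _ _ sym adj nonadj])
  show ?thesis by (rule no_quantum_symmetry_and_cring[OF q])
qed

section \<open>Common neighbours in the two torus graphs\<close>

lemma verts_torus:
  "pverts (direct_product K3 K3) = pverts K3 \<times> pverts K3"
  "pverts (cartesian_product K3 K3) = pverts K3 \<times> pverts K3"
  by (simp_all add: direct_product_def cartesian_product_def)

lemma arcs_K3: "(a, b) \<in> parcs K3 \<longleftrightarrow> a \<in> pverts K3 \<and> b \<in> pverts K3 \<and> a \<noteq> b"
  by (simp add: K3_def)

lemma arcs_torus:
  "(i, k) \<in> parcs (direct_product K3 K3) \<longleftrightarrow>
    i \<in> pverts K3 \<times> pverts K3 \<and> k \<in> pverts K3 \<times> pverts K3 \<and> fst i \<noteq> fst k \<and> snd i \<noteq> snd k"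
  "(i, k) \<in> parcs (cartesian_product K3 K3) \<longleftrightarrow>
    i \<in> pverts K3 \<times> pverts K3 \<and> k \<in> pverts K3 \<times> pverts K3 \<and> (fst i = fst k) \<noteq> (snd i = snd k)"
  by (cases i; cases k; auto simp: direct_product_def cartesian_product_def arcs_K3)+

lemma ex_third_K3:
  assumes "a \<in> pverts K3" "c \<in> pverts K3" "a \<noteq> c"
  shows "\<exists>e. \<forall>x. x \<in> pverts K3 \<and> a \<noteq> x \<and> x \<noteq> c \<longleftrightarrow> x = e"
proof -
  \<comment> \<open>The vertices \<open>1, 2, 3\<close> sum to \<open>6\<close>, so this is the
    remaining one.\<close>
  have "x \<in> pverts K3 \<and> a \<noteq> x \<and> x \<noteq> c \<longleftrightarrow> x = 6 - a - c" for x
    using assms by (auto simp: K3_def)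
  then show ?thesis by blast
qed

text \<open>Both coordinates of \<open>m\<close> are forced to be the third element.\<close>

lemma ex1_third_direct:
  assumes third: "\<And>a c. \<lbrakk>a \<in> W; c \<in> W; a \<noteq> c\<rbrakk> \<Longrightarrow> \<exists>e. \<forall>x. x \<in> W \<and> a \<noteq> x \<and> x \<noteq> c \<longleftrightarrow> x = e"
    and v: "i \<in> W \<times> W" "k \<in> W \<times> W" and ne: "fst i \<noteq> fst k" "snd i \<noteq> snd k"
  shows "\<exists>!m. m \<in> W \<times> W \<and> (fst i \<noteq> fst m \<and> snd i \<noteq> snd m) \<and> (fst m \<noteq> fst k \<and> snd m \<noteq> snd k)"
proof -
  have v': "fst i \<in> W" "snd i \<in> W" "fst k \<in> W" "snd k \<in> W" using v by auto
  obtain e f where "\<And>x. x \<in> W \<and> fst i \<noteq> x \<and> x \<noteq> fst k \<longleftrightarrow> x = e"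
      "\<And>x. x \<in> W \<and> snd i \<noteq> x \<and> x \<noteq> snd k \<longleftrightarrow> x = f"
    using third[OF v'(1,3) ne(1)] third[OF v'(2,4) ne(2)] by blast
  then have "m \<in> W \<times> W \<and> (fst i \<noteq> fst m \<and> snd i \<noteq> snd m) \<and> (fst m \<noteq> fst k \<and> snd m \<noteq> snd k)
      \<longleftrightarrow> m = (e, f)" for m
    by (cases m) (simp add: mem_Times_iff, blast)
  then show ?thesis by simp
qed

text \<open>A common neighbour keeps the coordinate shared by \<open>i\<close> and \<open>k\<close>:
  otherwise its other coordinate would equal two different values. In the other coordinate it takes
  the third element.\<close>

lemma ex1_third_cartesian:
  assumes third: "\<And>a c. \<lbrakk>a \<in> W; c \<in> W; a \<noteq> c\<rbrakk> \<Longrightarrow> \<exists>e. \<forall>x. x \<in> W \<and> a \<noteq> x \<and> x \<noteq> c \<longleftrightarrow> x = e"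
    and v: "i \<in> W \<times> W" "k \<in> W \<times> W" and ne: "(fst i = fst k) \<noteq> (snd i = snd k)"
  shows "\<exists>!m. m \<in> W \<times> W \<and> (fst i = fst m) \<noteq> (snd i = snd m) \<and> (fst m = fst k) \<noteq> (snd m = snd k)"
proof -
  have v': "fst i \<in> W" "snd i \<in> W" "fst k \<in> W" "snd k \<in> W" using v by auto
  consider "fst i = fst k" "snd i \<noteq> snd k" | "fst i \<noteq> fst k" "snd i = snd k" using ne by blast
  then show ?thesis
  proof cases
    case 1
    then obtain f where "\<And>x. x \<in> W \<and> snd i \<noteq> x \<and> x \<noteq> snd k \<longleftrightarrow> x = f"
      using third[OF v'(2,4)] by blast
    then have "m \<in> W \<times> W \<and> (fst i = fst m) \<noteq> (snd i = snd m) \<and> (fst m = fst k) \<noteq> (snd m = snd k)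
      \<longleftrightarrow> m = (fst i, f)" for m
      using v' 1 by (cases m) (simp add: mem_Times_iff, metis)
    then show ?thesis by simp
  next
    case 2
    then obtain e where "\<And>x. x \<in> W \<and> fst i \<noteq> x \<and> x \<noteq> fst k \<longleftrightarrow> x = e"
      using third[OF v'(1,3)] by blast
    then have "m \<in> W \<times> W \<and> (fst i = fst m) \<noteq> (snd i = snd m) \<and> (fst m = fst k) \<noteq> (snd m = snd k)
      \<longleftrightarrow> m = (e, snd i)" for m
      using v' 2 by (cases m) (simp add: mem_Times_iff, metis)
    then show ?thesis by simp
  qed
qed

text \<open>Distinct non-adjacent vertices agree in exactly one coordinate: the complement of the
  direct product is the Cartesian product.\<close>

lemma torus_direct_unique_common_neighbours:
  fixes G defines "G \<equiv> direct_product K3 K3"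
  assumes v: "i \<in> pverts G" "k \<in> pverts G"
  shows "(i, k) \<in> parcs G \<Longrightarrow> \<exists>!m. m \<in> pverts G \<and> (i, m) \<in> parcs G \<and> (m, k) \<in> parcs G"
    and "\<lbrakk>i \<noteq> k; (i, k) \<notin> parcs G\<rbrakk> \<Longrightarrow>
      \<exists>!m. m \<in> pverts G \<and> (i \<noteq> m \<and> (i, m) \<notin> parcs G) \<and> (m \<noteq> k \<and> (m, k) \<notin> parcs G)"
proof -
  have v': "i \<in> pverts K3 \<times> pverts K3" "k \<in> pverts K3 \<times> pverts K3"
    using v by (simp_all only: G_def verts_torus)
  have arc: "(p, q) \<in> parcs G \<longleftrightarrow> fst p \<noteq> fst q \<and> snd p \<noteq> snd q"
    "p \<noteq> q \<and> (p, q) \<notin> parcs G \<longleftrightarrow> (fst p = fst q) \<noteq> (snd p = snd q)"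
    if "p \<in> pverts G" "q \<in> pverts G" for p q
    using that unfolding G_def arcs_torus verts_torus by (auto simp: prod_eq_iff)
  show "\<exists>!m. m \<in> pverts G \<and> (i, m) \<in> parcs G \<and> (m, k) \<in> parcs G" if "(i, k) \<in> parcs G"
  proof -
    have "fst i \<noteq> fst k" "snd i \<noteq> snd k" using arc(1)[OF v] that by blast+
    from ex1_third_direct[OF ex_third_K3 v' this] show ?thesis
      using v arc(1) by (simp add: G_def verts_torus cong: conj_cong)
  qed
  show "\<exists>!m. m \<in> pverts G \<and> (i \<noteq> m \<and> (i, m) \<notin> parcs G) \<and> (m \<noteq> k \<and> (m, k) \<notin> parcs G)"
    if "i \<noteq> k" "(i, k) \<notin> parcs G"
  proof -
    have "(fst i = fst k) \<noteq> (snd i = snd k)" using arc(2)[OF v] that by blast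
    from ex1_third_cartesian[OF ex_third_K3 v' this] show ?thesis
      using v arc(2) by (simp add: G_def verts_torus cong: conj_cong)
  qed
qed

text \<open>The complement is now the direct product, so the two counting lemmas exchange
  roles.\<close>

lemma torus_cartesian_unique_common_neighbours:
  fixes G defines "G \<equiv> cartesian_product K3 K3"
  assumes v: "i \<in> pverts G" "k \<in> pverts G"
  shows "(i, k) \<in> parcs G \<Longrightarrow> \<exists>!m. m \<in> pverts G \<and> (i, m) \<in> parcs G \<and> (m, k) \<in> parcs G"
    and "\<lbrakk>i \<noteq> k; (i, k) \<notin> parcs G\<rbrakk> \<Longrightarrow>
      \<exists>!m. m \<in> pverts G \<and> (i \<noteq> m \<and> (i, m) \<notin> parcs G) \<and> (m \<noteq> k \<and> (m, k) \<notin> parcs G)"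
proof -
  have v': "i \<in> pverts K3 \<times> pverts K3" "k \<in> pverts K3 \<times> pverts K3"
    using v by (simp_all only: G_def verts_torus)
  have arc: "(p, q) \<in> parcs G \<longleftrightarrow> (fst p = fst q) \<noteq> (snd p = snd q)"
    "p \<noteq> q \<and> (p, q) \<notin> parcs G \<longleftrightarrow> fst p \<noteq> fst q \<and> snd p \<noteq> snd q"
    if "p \<in> pverts G" "q \<in> pverts G" for p q
    using that unfolding G_def arcs_torus verts_torus by (auto simp: prod_eq_iff)
  show "\<exists>!m. m \<in> pverts G \<and> (i, m) \<in> parcs G \<and> (m, k) \<in> parcs G" if "(i, k) \<in> parcs G"
  proof -
    have "(fst i = fst k) \<noteq> (snd i = snd k)" using arc(1)[OF v] that by blast
    from ex1_third_cartesian[OF ex_third_K3 v' this] show ?thesis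
      using v arc(1) by (simp add: G_def verts_torus cong: conj_cong)
  qed
  show "\<exists>!m. m \<in> pverts G \<and> (i \<noteq> m \<and> (i, m) \<notin> parcs G) \<and> (m \<noteq> k \<and> (m, k) \<notin> parcs G)"
    if "i \<noteq> k" "(i, k) \<notin> parcs G"
  proof -
    have "fst i \<noteq> fst k" "snd i \<noteq> snd k" using arc(2)[OF v] that by blast+
    from ex1_third_direct[OF ex_third_K3 v' this] show ?thesis
      using v arc(2) by (simp add: G_def verts_torus cong: conj_cong)
  qed
qed

section \<open>The isomorphism between the two products\<close>

text \<open>A \<open>digraph_iso\<close> also involves maps for arcs, heads and tails. Arcs here are
  pairs of vertices, so \<open>f\<close> forces \<open>map_prod f f\<close>, \<open>snd\<close> and
  \<open>fst\<close>.\<close>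

lemma digraph_iso_with_projI:
  assumes G: "pair_wf_digraph G" and H: "pair_wf_digraph H"
    and inj: "inj_on f (pverts G)" and surj: "f ` pverts G = pverts H"
    and arc: "\<And>p q. \<lbrakk>p \<in> pverts G; q \<in> pverts G\<rbrakk> \<Longrightarrow> (p, q) \<in> parcs G \<longleftrightarrow> (f p, f q) \<in> parcs H"
  shows "digraph_iso (with_proj G) (with_proj H)"
proof -
  interpret G: pair_wf_digraph G by fact
  interpret H: pair_wf_digraph H by fact
  let ?h = "\<lparr>iso_verts = f, iso_arcs = map_prod f f, iso_head = snd, iso_tail = fst\<rparr>"
  have sub: "parcs G \<subseteq> pverts G \<times> pverts G" by (auto dest: G.in_arcsD1 G.in_arcsD2)
  have arcs: "map_prod f f ` parcs G = parcs H"
  proof (intro equalityI subsetI)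
    fix x assume "x \<in> map_prod f f ` parcs G"
    then show "x \<in> parcs H" using arc sub by auto
  next
    fix x assume x: "x \<in> parcs H"
    then have "fst x \<in> pverts H" "snd x \<in> pverts H"
      by (metis H.in_arcsD1 prod.collapse, metis H.in_arcsD2 prod.collapse)
    then obtain p q where "x = (f p, f q)" "p \<in> pverts G" "q \<in> pverts G"
      using surj by (metis imageE prod.collapse)
    then show "x \<in> map_prod f f ` parcs G" using x arc[of p q] by force
  qed
  have "inj_on (map_prod f f) (parcs G)"
    by (rule inj_on_subset[OF map_prod_inj_on[OF inj inj] sub])
  then have "pre_digraph.digraph_isomorphism (with_proj G) ?h"
    using inj G.wf_digraph by (auto simp: pre_digraph.digraph_isomorphism_def)
  moreover have "with_proj H = app_iso ?h (with_proj G)"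
    using surj arcs by (simp add: app_iso_def with_proj_def)
  ultimately show ?thesis unfolding digraph_iso_def by blast
qed

text \<open>The vertex map takes sum and difference modulo 3, with \<open>2 * b\<close> in place of
  \<open>- b\<close>; adding \<open>1\<close> turns residues into the vertices
  \<open>1, 2, 3\<close>.\<close>

lemma digraph_iso_torus:
  "digraph_iso (with_proj (direct_product K3 K3)) (with_proj (cartesian_product K3 K3))"
proof (rule digraph_iso_with_projI)
  let ?D = "direct_product K3 K3" and ?C = "cartesian_product K3 K3"
  \<comment> \<open>two points of \<open>\<int>/3 \<times> \<int>/3\<close> differ in both coordinates iff they agree in exactly one of the
    sum and the difference of the coordinates\<close>
  let ?f = "\<lambda>(a :: nat, b). ((a + b) mod 3 + 1, (a + 2 * b) mod 3 + 1)"
  interpret D: pair_graph ?D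
    by (intro pair_graph_direct_product pair_graph_K3)
  interpret C: pair_graph ?C
    by (intro pair_graph_cartesian_product pair_graph_K3)
  show "pair_wf_digraph ?D" "pair_wf_digraph ?C"
    by (rule D.pair_wf_digraph_axioms C.pair_wf_digraph_axioms)+
  have W: "pverts K3 \<times> pverts K3 = {(1,1),(1,2),(1,3),(2,1),(2,2),(2,3),(3,1),(3,2),(3,3)}"
    by (auto simp: K3_def)
  show inj: "inj_on ?f (pverts ?D)"
    unfolding verts_torus W by (simp add: inj_on_def)
  \<comment> \<open>Both graphs have the same finite vertex set, so an injective map of it into
    itself is onto.\<close>
  have "?f ` pverts ?D \<subseteq> pverts ?D"
    unfolding verts_torus W by simp
  then show f: "?f ` pverts ?D = pverts ?C"
    using inj unfolding verts_torus by (intro endo_inj_surj) (auto simp: K3_def)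
  have "\<forall>p\<in>pverts K3 \<times> pverts K3. \<forall>q\<in>pverts K3 \<times> pverts K3. fst p \<noteq> fst q \<and> snd p \<noteq> snd q \<longleftrightarrow>
      (fst (?f p) = fst (?f q)) \<noteq> (snd (?f p) = snd (?f q))"
    unfolding W by simp
  then show "(p, q) \<in> parcs ?D \<longleftrightarrow> (?f p, ?f q) \<in> parcs ?C"
    if "p \<in> pverts ?D" "q \<in> pverts ?D" for p q
    using that f unfolding arcs_torus verts_torus by blast
qed

theorem theorem5p1:
  shows "digraph_iso (with_proj (direct_product K3 K3)) (with_proj (cartesian_product K3 K3)) \<and>
    (\<forall>Torus \<in> {direct_product K3 K3, cartesian_product K3 K3}.
      \<forall>(A :: 'a cstar_algebra) u. is_quantum_aut_algebra Torus A u \<longrightarrow>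
        no_quantum_symmetry Torus A u \<and> cring A)"
proof -
  have "no_quantum_symmetry (direct_product K3 K3) A u \<and> cring A"
    if "is_quantum_aut_algebra (direct_product K3 K3) A u" for A :: "'a cstar_algebra" and u
    by (rule no_quantum_symmetry_if_unique_common_neighbours[OF
          pair_graph_direct_product[OF pair_graph_K3 pair_graph_K3] that
          torus_direct_unique_common_neighbours])
  moreover have "no_quantum_symmetry (cartesian_product K3 K3) A u \<and> cring A"
    if "is_quantum_aut_algebra (cartesian_product K3 K3) A u" for A :: "'a cstar_algebra" and u
    by (rule no_quantum_symmetry_if_unique_common_neighbours[OF
          pair_graph_cartesian_product[OF pair_graph_K3 pair_graph_K3] that
          torus_cartesian_unique_common_neighbours])
  ultimately show ?thesis using digraph_iso_torus by auto
qed

end
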